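(* Let $\Phi$ be a non-autonomous finite conformal iterated function system, with initial set $J\subset\mathbb R^d$, satisfying the open set condition, and let $E$ be its non-autonomous finite conformal set. Suppose that $\mathcal L^d(\partial J)=0$ and that $$\lim_{k\to+\infty}\frac{\log \overline c_k-\log \#I_k}{\log M_k}=0 .$$ Then the Hausdorff dimension of $E$ is given by $$\dim_{\rm H}E=s_* .$$
   Context: $\mathcal L^d$ is $d$-dimensional Lebesgue measure. Words. $\{I_k\}_{k\ge 1}$ is a sequence of index sets with $2\le \#I_k<\infty$. For $k\ge l\ge 1$, $\Sigma_l^k=\{u_l\cdots u_k: u_j\in I_j\}$; $\Sigma^k=\Sigma_1^k$, $\Sigma^0=\{\emptyset\}$, $\Sigma^*=\bigcup_{k\ge 0}\Sigma^k$. System. $J\subset\mathbb R^d$ is compact with non-empty interior and $\overline{\mathrm{int}(J)}=J$. For each $k\ge1$, $\Phi_k=\{\varphi_{k,i}\}_{i\in I_k}$ is a family of maps $\varphi_{k,i}:J\to J$. For $\mathbf u=u_l\cdots u_k\in\Sigma_l^k$, $\varphi_{\mathbf u}=\varphi_{l,u_l}\circ\cdots\circ\varphi_{k,u_k}$ (and $\varphi_\emptyset=\mathrm{id}$). $\Phi=\{\Phi_k\}_{k\ge1}$, together with a family $\{J_{\mathbf u}:\mathbf u\in\Sigma^*\}$ of closed subsets of $J$, is a non-autonomous finite iterated function system if: (i) there is $0<c<1$ with $|\varphi_{k,i}(x)-\varphi_{k,i}(y)|\le c|x-y|$ for all $k$, $i\in I_k$, $x,y\in J$; (ii) $J_\emptyset=J$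 and $J_{\mathbf u i}\subset J_{\mathbf u}$ for all $\mathbf u\in\Sigma^{k-1}$, $i\in I_k$, $k\ge1$; (iii) for each $\mathbf u\in\Sigma^*$ there is $\omega_{\mathbf u}\in\mathbb R^d$ such that $J_{\mathbf u}=\Psi_{\mathbf u}(J)$ with $\Psi_{\mathbf u}=\varphi_{\mathbf u}+\omega_{\mathbf u}$. Its attractor is $E=\bigcap_{k\ge1}\bigcup_{\mathbf u\in\Sigma^k}J_{\mathbf u}$. The open set condition (OSC) means: for all $k\ge0$, $\mathbf u\in\Sigma^k$ and $i\ne j\in I_{k+1}$, $\mathrm{int}(J_{\mathbf ui})\cap\mathrm{int}(J_{\mathbf uj})=\emptyset$. Conformality. $\Phi$ is conformal (and $E$ is called a non-autonomous finite conformal set) if there is an open connected set $V\supset J$, independent of $k$, such that each $\varphi_{k,j}$ extends to a $C^1$ conformal diffeomorphism of $V$ into $V$ (the derivative at each point is a similarity linear map), and there is $C\ge1$ with $\|D\varphi_{\mathbf u}(x)\|\le C\|D\varphi_{\mathbf u}(y)\|$ for all $x,y\in V$ and all $\mathbf u\in\Sigma_l^k$, $k\ge l\ge1$. Here $\|D\varphi(x)\|$ is the scaling factor of $D\varphi(x)$ and $\|D\varphi\|=\sup_{x\in J}\|D\varphi(x)\|$. Put $M_k=\sup_{\mathbf u\in\Sigma^k}\|D\varphi_{\mathbf u}\|$ and $\overline c_k=\sup_{j\in I_k}\|D\varphi_{k,j}\|$. Lower pressure: $\underline P(t)=\liminf_{k\to\infty}\frac1k\log\sum_{\mathbf u\in\Sigma^k}\|D\varphi_{\mathbf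 u}\|^t$, and $s_*=\inf\{t:\underline P(t)<0\}=\sup\{t:\underline P(t)>0\}$. *)

theory Defs
  imports "HOL-Analysis.Analysis"
begin

section \<open>Hausdorff measure and Hausdorff dimension\<close>

text \<open>The value |U|^s with the usual conventions |\<emptyset>|^s = 0 and |U|^0 = 1 for nonempty U; the
  case split is needed because \<open>0 powr 0 = 0\<close> in HOL.\<close>

definition diam_pow :: "real \<Rightarrow> 'a::metric_space set \<Rightarrow> real" where
  "diam_pow s U = (if U = {} then 0 else if s = 0 then 1 else diameter U powr s)"

text \<open>Boundedness is required explicitly because \<open>diameter\<close> is unspecified on unbounded sets.\<close>

definition delta_covers :: "real \<Rightarrow> 'a::metric_space set \<Rightarrow> (nat \<Rightarrow> 'a set) set" where
  "delta_covers \<delta> A =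
     {U. A \<subseteq> (\<Union>n. U n) \<and> (\<forall>n. bounded (U n) \<and> diameter (U n) \<le> \<delta>)}"

definition hausdorff_measure :: "real \<Rightarrow> 'a::metric_space set \<Rightarrow> ennreal" where
  "hausdorff_measure s A =
     (SUP \<delta>\<in>{0<..}. INF U\<in>delta_covers \<delta> A. \<Sum>n. ennreal (diam_pow s (U n)))"

definition hausdorff_dim :: "'a::metric_space set \<Rightarrow> ereal" where
  "hausdorff_dim A = Inf {ereal s | s. 0 \<le> s \<and> hausdorff_measure s A = 0}"


section \<open>Words\<close>

text \<open>\<open>words I l k\<close> is \<open>\<Sigma>\<^sub>l\<^sup>k\<close>: the word \<open>u\<^sub>l \<dots> u\<^sub>k\<close> is a list whose entry at
  position \<open>j\<close> (counted from 0) lies in \<open>I (l + j)\<close>. Only the index sets \<open>I k\<close> with \<open>k \<ge> 1\<close> matter.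
  In particular \<open>words I 1 k\<close> is \<open>\<Sigma>\<^sup>k\<close>, including \<open>\<Sigma>\<^sup>0 = {[]}\<close>.\<close>

definition words :: "(nat \<Rightarrow> 'i set) \<Rightarrow> nat \<Rightarrow> nat \<Rightarrow> 'i list set" where
  "words I l k = {u. length u = Suc k - l \<and> (\<forall>j<length u. u ! j \<in> I (l + j))}"

definition all_words :: "(nat \<Rightarrow> 'i set) \<Rightarrow> 'i list set" where
  "all_words I = (\<Union>k. words I 1 k)"

text \<open>\<open>word_map \<phi> l u\<close> is \<open>\<phi>\<^sub>u = \<phi>\<^sub>l\<^sub>,\<^sub>u\<^sub>l \<circ> \<dots> \<circ> \<phi>\<^sub>k\<^sub>,\<^sub>u\<^sub>k\<close>
  for \<open>u = u\<^sub>l \<dots> u\<^sub>k\<close>; the starting level \<open>l\<close> is not recorded in the list.\<close>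

primrec word_map :: "(nat \<Rightarrow> 'i \<Rightarrow> 'a \<Rightarrow> 'a) \<Rightarrow> nat \<Rightarrow> 'i list \<Rightarrow> 'a \<Rightarrow> 'a" where
  "word_map \<phi> l [] = id"
| "word_map \<phi> l (i # u) = \<phi> l i \<circ> word_map \<phi> (Suc l) u"


section \<open>Non-autonomous finite iterated function systems\<close>

text \<open>Here \<open>K u\<close> is the set \<open>J\<^sub>u\<close>. The maps \<open>\<phi> k i\<close> are constrained, and used, only on \<open>J\<close>.\<close>

definition nonautonomous_IFS ::
  "(nat \<Rightarrow> 'i set) \<Rightarrow> 'a::euclidean_space set \<Rightarrow> (nat \<Rightarrow> 'i \<Rightarrow> 'a \<Rightarrow> 'a) \<Rightarrow> ('i list \<Rightarrow> 'a set) \<Rightarrow> bool"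
where
  "nonautonomous_IFS I J \<phi> K \<longleftrightarrow>
     (\<forall>k\<ge>1. finite (I k) \<and> 2 \<le> card (I k)) \<and>
     compact J \<and> interior J \<noteq> {} \<and> closure (interior J) = J \<and>
     (\<forall>k\<ge>1. \<forall>i\<in>I k. \<phi> k i ` J \<subseteq> J) \<and>
     (\<forall>u\<in>all_words I. closed (K u) \<and> K u \<subseteq> J) \<and>
     (\<exists>c. 0 < c \<and> c < 1 \<and>
        (\<forall>k\<ge>1. \<forall>i\<in>I k. \<forall>x\<in>J. \<forall>y\<in>J. norm (\<phi> k i x - \<phi> k i y) \<le> c * norm (x - y))) \<and>
     K [] = J \<and>
     (\<forall>k\<ge>1. \<forall>u\<in>words I 1 (k - 1). \<forall>i\<in>I k. K (u @ [i]) \<subseteq> K u) \<and>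
     (\<forall>u\<in>all_words I. \<exists>\<omega>. K u = (\<lambda>x. word_map \<phi> 1 u x + \<omega>) ` J)"

definition attractor :: "(nat \<Rightarrow> 'i set) \<Rightarrow> ('i list \<Rightarrow> 'a set) \<Rightarrow> 'a set" where
  "attractor I K = (\<Inter>k\<in>{1..}. \<Union>u\<in>words I 1 k. K u)"

definition open_set_condition ::
  "(nat \<Rightarrow> 'i set) \<Rightarrow> ('i list \<Rightarrow> 'a::topological_space set) \<Rightarrow> bool" where
  "open_set_condition I K \<longleftrightarrow>
     (\<forall>k. \<forall>u\<in>words I 1 k. \<forall>i\<in>I (k + 1). \<forall>j\<in>I (k + 1).
        i \<noteq> j \<longrightarrow> interior (K (u @ [i])) \<inter> interior (K (u @ [j])) = {})"


section \<open>Conformality\<close>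

definition C1_on :: "'a::euclidean_space set \<Rightarrow> ('a \<Rightarrow> 'a) \<Rightarrow> bool" where
  "C1_on V f \<longleftrightarrow>
     (\<exists>f' :: 'a \<Rightarrow> 'a \<Rightarrow>\<^sub>L 'a.
        (\<forall>x\<in>V. (f has_derivative blinfun_apply (f' x)) (at x)) \<and> continuous_on V f')"

definition C1_diffeo_into :: "'a::euclidean_space set \<Rightarrow> ('a \<Rightarrow> 'a) \<Rightarrow> bool" where
  "C1_diffeo_into V f \<longleftrightarrow>
     f ` V \<subseteq> V \<and> open (f ` V) \<and> inj_on f V \<and> C1_on V f \<and> C1_on (f ` V) (inv_into V f)"

definition similarity_linear :: "('a::real_normed_vector \<Rightarrow> 'a) \<Rightarrow> bool" where
  "similarity_linear L \<longleftrightarrow> linear L \<and> (\<exists>r>0. \<forall>v. norm (L v) = r * norm v)"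

definition scaling_factor :: "('a::real_normed_vector \<Rightarrow> 'a) \<Rightarrow> real" where
  "scaling_factor L = (THE r. \<forall>v. norm (L v) = r * norm v)"

definition D_scale :: "('a::real_normed_vector \<Rightarrow> 'a) \<Rightarrow> 'a \<Rightarrow> real" where
  "D_scale f x = scaling_factor (frechet_derivative f (at x))"

definition conformal_diffeo_into :: "'a::euclidean_space set \<Rightarrow> ('a \<Rightarrow> 'a) \<Rightarrow> bool" where
  "conformal_diffeo_into V f \<longleftrightarrow>
     C1_diffeo_into V f \<and> (\<forall>x\<in>V. similarity_linear (frechet_derivative f (at x)))"

text \<open>\<open>\<psi> k i\<close> is the extension of \<open>\<phi> k i\<close> to \<open>V\<close>; a system is conformal iff some \<open>V\<close> and \<open>\<psi>\<close>
  satisfy this predicate. The extension is kept explicit because the derivatives at points of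
  the boundary of \<open>J\<close> are those of the extended maps.\<close>

definition conformal_extension ::
  "(nat \<Rightarrow> 'i set) \<Rightarrow> 'a::euclidean_space set \<Rightarrow> (nat \<Rightarrow> 'i \<Rightarrow> 'a \<Rightarrow> 'a) \<Rightarrow>
   'a set \<Rightarrow> (nat \<Rightarrow> 'i \<Rightarrow> 'a \<Rightarrow> 'a) \<Rightarrow> bool"
where
  "conformal_extension I J \<phi> V \<psi> \<longleftrightarrow>
     open V \<and> connected V \<and> J \<subseteq> V \<and>
     (\<forall>k\<ge>1. \<forall>i\<in>I k. (\<forall>x\<in>J. \<psi> k i x = \<phi> k i x) \<and> conformal_diffeo_into V (\<psi> k i)) \<and>
     (\<exists>C\<ge>1. \<forall>l\<ge>1. \<forall>k\<ge>l. \<forall>u\<in>words I l k. \<forall>x\<in>V. \<forall>y\<in>V.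
        D_scale (word_map \<psi> l u) x \<le> C * D_scale (word_map \<psi> l u) y)"

definition D_norm :: "'a::real_normed_vector set \<Rightarrow> ('a \<Rightarrow> 'a) \<Rightarrow> real" where
  "D_norm J f = (SUP x\<in>J. D_scale f x)"

definition M_max ::
  "(nat \<Rightarrow> 'i set) \<Rightarrow> 'a::real_normed_vector set \<Rightarrow> (nat \<Rightarrow> 'i \<Rightarrow> 'a \<Rightarrow> 'a) \<Rightarrow> nat \<Rightarrow> real" where
  "M_max I J \<psi> k = (SUP u\<in>words I 1 k. D_norm J (word_map \<psi> 1 u))"

definition c_max ::
  "(nat \<Rightarrow> 'i set) \<Rightarrow> 'a::real_normed_vector set \<Rightarrow> (nat \<Rightarrow> 'i \<Rightarrow> 'a \<Rightarrow> 'a) \<Rightarrow> nat \<Rightarrow> real" where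
  "c_max I J \<psi> k = (SUP j\<in>I k. D_norm J (\<psi> k j))"


section \<open>Lower pressure\<close>

definition lower_pressure ::
  "(nat \<Rightarrow> 'i set) \<Rightarrow> 'a::real_normed_vector set \<Rightarrow> (nat \<Rightarrow> 'i \<Rightarrow> 'a \<Rightarrow> 'a) \<Rightarrow> real \<Rightarrow> ereal" where
  "lower_pressure I J \<psi> t =
     liminf (\<lambda>k. ereal (1 / real k * ln (\<Sum>u\<in>words I 1 k. D_norm J (word_map \<psi> 1 u) powr t)))"

definition s_star ::
  "(nat \<Rightarrow> 'i set) \<Rightarrow> 'a::real_normed_vector set \<Rightarrow> (nat \<Rightarrow> 'i \<Rightarrow> 'a \<Rightarrow> 'a) \<Rightarrow> ereal" where
  "s_star I J \<psi> = Inf {ereal t | t. lower_pressure I J \<psi> t < 0}"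

end

theory Submission
  imports Defs
begin

text \<open>
  Write \<open>W u = \<parallel>D\<phi>\<^sub>u\<parallel>\<close>, \<open>Z s k = (\<Sum>u\<in>\<Sigma>\<^sup>k. W u powr s)\<close> and \<open>M k\<close> for the largest \<open>W u\<close> at level
  \<open>k\<close>. Bounded distortion makes \<open>W\<close> multiplicative up to a constant, and turns it into the size of the
  cylinder \<open>J\<^sub>u\<close>: its diameter is at most a constant times \<open>W u\<close>
  (\<open>uniform_mean_value_on_compact\<close>), and it contains a ball of radius at least a constant times \<open>W u\<close>
  (\<open>ball_subset_conformal_image\<close>). The translations \<open>\<omega>\<^sub>u\<close> are arbitrary, but these facts do not see
  them.

  Upper bound. If the lower pressure at \<open>t\<close> is negative, then \<open>Z t k\<close> is arbitrarily small at
  infinitely many levels, and covering the attractor by the cylinders of these levels shows that its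
  \<open>t\<close>-dimensional measure vanishes.

  Lower bound. Let \<open>s < s_*\<close> and give each \<open>u \<in> \<Sigma>\<^sup>n\<close> the mass \<open>W u powr s / Z s n\<close>. By
  quasi-multiplicativity a cylinder of level \<open>m \<le> n\<close> carries mass at most a constant times
  \<open>W w powr s / Z s m\<close>. To estimate the mass of a ball \<open>B\<close> of radius \<open>r\<close>, cut every word at the first
  place where its weight is at most \<open>r\<close>. The parents of the cut words are cylinders larger than \<open>r\<close>
  that meet \<open>B\<close>; sorting them by level and by dyadic size, the open set condition and a comparison of
  volumes leave a bounded number for each level and size, since at size \<open>\<rho> \<ge> r\<close> the cylinders may be
  tested against the concentric ball of radius \<open>\<rho>\<close>. A parent of level \<open>m\<close> has \<open>card (I (m + 1))\<close>
  children, which may be far smaller than \<open>r\<close> and of very different sizes; so the mass of \<open>B\<close> is at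
  most a constant times \<open>r\<^sup>s log (1 / r) \<Sum>\<^sub>m card (I (m + 1)) / Z s (m + 1)\<close>. As
  \<open>c_max\<close> is bounded, the growth hypothesis makes \<open>card (I k)\<close> eventually smaller than every negative
  power of \<open>M k\<close>, whereas \<open>s < s_*\<close> forces \<open>Z s k\<close>
  above some fixed negative power of \<open>M k\<close>. Since \<open>M k\<close> decays geometrically, the series converges, and
  the mass of \<open>B\<close> is at most a constant times \<open>r\<^sup>t\<close> for every \<open>t < s\<close>, uniformly in \<open>n\<close>. The mass
  distribution principle concludes.
\<close>

section \<open>Words\<close>

lemma words_less: "k < l \<Longrightarrow> words I l k = {[]}"
  by (auto simp: words_def)

lemma words_append_iff:
  assumes "w \<in> words I l m" "l \<le> Suc m" "m \<le> n"
  shows "w @ v \<in> words I l n \<longleftrightarrow> v \<in> words I (Suc m) n"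
proof -
  have len: "length w = Suc m - l" and w: "\<And>j. j < length w \<Longrightarrow> w ! j \<in> I (l + j)"
    using assms(1) by (auto simp: words_def)
  have "(\<forall>j<length w + length v. (w @ v) ! j \<in> I (l + j)) \<longleftrightarrow>
      (\<forall>j<length v. v ! j \<in> I (Suc m + j))"
  proof safe
    fix j assume j: "\<forall>j<length w + length v. (w @ v) ! j \<in> I (l + j)" "j < length v"
    then have "(w @ v) ! (length w + j) \<in> I (l + (length w + j))"
      by (metis add_less_cancel_left)
    moreover have "l + (length w + j) = Suc m + j" using len assms(2) by simp
    ultimately show "v ! j \<in> I (Suc m + j)" by simp
  next
    fix j assume j: "\<forall>j<length v. v ! j \<in> I (Suc m + j)" "j < length w + length v"
    show "(w @ v) ! j \<in> I (l + j)"
    proof (cases "j < length w")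
      case True
      then show ?thesis using w by (simp add: nth_append)
    next
      case False
      then have "j - length w < length v" using j(2) by simp
      then have "v ! (j - length w) \<in> I (Suc m + (j - length w))" using j(1) by blast
      moreover have "Suc m + (j - length w) = l + j" using False len assms(2) by simp
      ultimately show ?thesis using False by (simp add: nth_append)
    qed
  qed
  then show ?thesis using len assms(2,3) by (auto simp: words_def)
qed

lemma words_take:
  assumes "u \<in> words I l n" "l \<le> Suc m" "m \<le> n"
  shows "take (Suc m - l) u \<in> words I l m"
  using assms by (auto simp: words_def)

lemma words_snoc_iff: "l \<le> Suc k \<Longrightarrow> u \<in> words I l k \<Longrightarrow> u @ [i] \<in> words I l (Suc k) \<longleftrightarrow> i \<in> I (Suc k)"
  by (subst words_append_iff[of _ _ _ k]) (auto simp: words_def)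

lemma words_Suc:
  assumes "l \<le> Suc k"
  shows "words I l (Suc k) = (\<lambda>(u, i). u @ [i]) ` (words I l k \<times> I (Suc k))"
proof -
  have "u \<in> (\<lambda>(u, i). u @ [i]) ` (words I l k \<times> I (Suc k))" if u: "u \<in> words I l (Suc k)" for u
  proof -
    have len: "length u = Suc (Suc k - l)" using u assms by (simp add: words_def)
    then have eq: "u = take (Suc k - l) u @ [last u]"
      by (metis append_butlast_last_id butlast_conv_take diff_Suc_1 length_0_conv nat.distinct(1))
    have "take (Suc k - l) u \<in> words I l k" using words_take[OF u assms] by simp
    moreover from this have "last u \<in> I (Suc k)" using u eq words_snoc_iff[OF assms] by metis
    ultimately show ?thesis using eq by (intro image_eqI[of _ _ "(take (Suc k - l) u, last u)"]) auto
  qed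
  then show ?thesis by (auto simp: words_snoc_iff[OF assms])
qed

lemma finite_words:
  assumes "\<And>k. 1 \<le> k \<Longrightarrow> finite (I k)" "1 \<le> l"
  shows "finite (words I l k)"
proof (induction k)
  case 0
  then show ?case using assms by (subst words_less) auto
next
  case (Suc k)
  then show ?case using assms by (cases "l \<le> Suc k") (auto simp: words_Suc words_less)
qed

lemma words_nonempty:
  assumes "\<And>k. 1 \<le> k \<Longrightarrow> I k \<noteq> {}" "1 \<le> l"
  shows "words I l k \<noteq> {}"
proof (induction k)
  case 0
  then show ?case using assms by (subst words_less) auto
next
  case (Suc k)
  then show ?case using assms by (cases "l \<le> Suc k") (auto simp: words_Suc words_less)
qed

text \<open>Splitting words at level \<open>m\<close> turns a sum over \<open>\<Sigma>\<^sup>n\<close> into a double sum over beginnings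
  and continuations, which is how the partition sums of different levels are compared.\<close>

lemma bij_betw_words_append:
  assumes "m \<le> n"
  shows "bij_betw (\<lambda>(w, v). w @ v) (words I 1 m \<times> words I (Suc m) n) (words I 1 n)"
proof (rule bij_betwI[where g = "\<lambda>u. (take m u, drop m u)"])
  show "(\<lambda>(w, v). w @ v) \<in> words I 1 m \<times> words I (Suc m) n \<rightarrow> words I 1 n"
    using assms by (auto simp: words_append_iff)
  show "(\<lambda>u. (take m u, drop m u)) \<in> words I 1 n \<rightarrow> words I 1 m \<times> words I (Suc m) n"
  proof
    fix u assume u: "u \<in> words I 1 n"
    then have "take m u \<in> words I 1 m" using words_take[of u I 1 n m] assms by simp
    moreover from this have "drop m u \<in> words I (Suc m) n"
      using words_append_iff[of "take m u" I 1 m n "drop m u"] u assms by simp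
    ultimately show "(take m u, drop m u) \<in> words I 1 m \<times> words I (Suc m) n" by simp
  qed
qed (auto simp: words_def)

lemma words_extensions:
  assumes "m \<le> n" "w \<in> words I 1 m"
  shows "{u \<in> words I 1 n. take m u = w} = (\<lambda>v. w @ v) ` words I (Suc m) n"
proof -
  have len: "length w = m" using assms by (simp add: words_def)
  have "u \<in> (\<lambda>v. w @ v) ` words I (Suc m) n" if "u \<in> words I 1 n" "take m u = w" for u
  proof -
    have u: "u = w @ drop m u" using that(2) append_take_drop_id[of m u] by simp
    then have "drop m u \<in> words I (Suc m) n"
      using words_append_iff[OF assms(2) _ assms(1), of "drop m u"] that(1) by simp
    then show ?thesis using u by blast
  qed
  then show ?thesis using len assms by (auto simp: words_append_iff)
qed


lemma words_Cons:
  assumes "i # u \<in> words I l k"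
  shows "i \<in> I l" "u \<in> words I (Suc l) k"
proof -
  have len: "Suc (length u) = Suc k - l"
    and entry: "\<And>j. j < Suc (length u) \<Longrightarrow> (i # u) ! j \<in> I (l + j)"
    using assms by (auto simp: words_def)
  show "i \<in> I l" using entry[of 0] by simp
  have "u ! j \<in> I (Suc l + j)" if "j < length u" for j using entry[of "Suc j"] that by simp
  then show "u \<in> words I (Suc l) k" using len by (simp add: words_def)
qed

lemma word_map_append: "word_map f l (u @ v) = word_map f l u \<circ> word_map f (l + length u) v"
  by (induction u arbitrary: l) (auto simp: fun_eq_iff)


section \<open>Hausdorff measure zero\<close>

text \<open>A finite cover becomes an admissible sequence by appending empty sets, which cost nothing
  even when \<open>s = 0\<close>.\<close>

lemma hausdorff_measure_eq_0I:
  fixes A :: "'a::metric_space set"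
  assumes "\<And>\<delta> e. 0 < \<delta> \<Longrightarrow> 0 < e \<Longrightarrow>
    \<exists>T S. finite T \<and> A \<subseteq> (\<Union>u\<in>T. S u) \<and> (\<forall>u\<in>T. bounded (S u) \<and> diameter (S u) \<le> \<delta>) \<and>
      (\<Sum>u\<in>T. diam_pow s (S u)) \<le> e"
  shows "hausdorff_measure s A = 0"
proof -
  have dp: "0 \<le> diam_pow s U" for U :: "'a set" by (simp add: diam_pow_def)
  have "(INF U\<in>delta_covers \<delta> A. \<Sum>n. ennreal (diam_pow s (U n))) \<le> 0" if "0 < \<delta>" for \<delta>
  proof (rule ennreal_le_epsilon)
    fix e :: real assume "0 < e"
    obtain T :: "'b set" and S where TS: "finite T" "A \<subseteq> (\<Union>u\<in>T. S u)"
      "\<forall>u\<in>T. bounded (S u) \<and> diameter (S u) \<le> \<delta>" "(\<Sum>u\<in>T. diam_pow s (S u)) \<le> e"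
      using assms[OF \<open>0 < \<delta>\<close> \<open>0 < e\<close>] by blast
    obtain h where h: "bij_betw h {0..<card T} T"
      using ex_bij_betw_nat_finite[OF TS(1)] by blast
    define U where "U n = (if n < card T then S (h n) else {})" for n
    have U: "U \<in> delta_covers \<delta> A"
    proof -
      have "A \<subseteq> (\<Union>n. U n)"
      proof
        fix x assume "x \<in> A"
        then obtain u where "u \<in> T" "x \<in> S u" using TS(2) by blast
        then obtain n where "n < card T" "h n = u"
          using h by (metis atLeastLessThan_iff bij_betw_imp_surj_on imageE)
        then show "x \<in> (\<Union>n. U n)" using \<open>x \<in> S u\<close> by (auto simp: U_def)
      qed
      moreover have "h n \<in> T" if "n < card T" for n
        using h that by (auto dest: bij_betw_apply)
      ultimately show ?thesis
        using TS(3) \<open>0 < \<delta>\<close> by (auto simp: delta_covers_def U_def)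
    qed
    have "(\<Sum>n. ennreal (diam_pow s (U n))) = (\<Sum>n\<in>{0..<card T}. ennreal (diam_pow s (U n)))"
      by (rule suminf_finite) (auto simp: U_def diam_pow_def)
    also have "\<dots> = ennreal (\<Sum>n\<in>{0..<card T}. diam_pow s (S (h n)))"
      unfolding U_def using dp by (subst sum_ennreal) auto
    also have "\<dots> = ennreal (\<Sum>u\<in>T. diam_pow s (S u))"
      using sum.reindex_bij_betw[OF h, of "\<lambda>u. diam_pow s (S u)"] by simp
    also have "\<dots> \<le> 0 + ennreal e" using TS(4) by (simp add: ennreal_leI)
    finally show "(INF U\<in>delta_covers \<delta> A. \<Sum>n. ennreal (diam_pow s (U n))) \<le> 0 + ennreal e"
      using U by (meson INF_lower2)
  qed
  then show ?thesis
    unfolding hausdorff_measure_def by (intro antisym SUP_least) auto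
qed

text \<open>The cost of the cover is recorded through finite subfamilies, because the covers are cut down
  to finite ones by compactness.\<close>

lemma hausdorff_measure_0_cover:
  fixes A :: "'a::metric_space set"
  assumes "hausdorff_measure s A = 0" "0 < \<delta>" "0 < e"
  obtains U where "U \<in> delta_covers \<delta> A" "\<And>F. finite F \<Longrightarrow> (\<Sum>n\<in>F. diam_pow s (U n)) \<le> e"
proof -
  have dp: "0 \<le> diam_pow s U" for U :: "'a set" by (simp add: diam_pow_def)
  have "(INF U\<in>delta_covers \<delta> A. \<Sum>n. ennreal (diam_pow s (U n))) \<le> hausdorff_measure s A"
    unfolding hausdorff_measure_def using \<open>0 < \<delta>\<close> by (intro SUP_upper) auto
  also have "\<dots> < ennreal e" using assms by simp
  finally obtain U where U: "U \<in> delta_covers \<delta> A" "(\<Sum>n. ennreal (diam_pow s (U n))) < ennreal e"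
    by (auto simp: INF_less_iff)
  have "(\<Sum>n\<in>F. diam_pow s (U n)) \<le> e" if "finite F" for F
  proof -
    have "ennreal (\<Sum>n\<in>F. diam_pow s (U n)) = (\<Sum>n\<in>F. ennreal (diam_pow s (U n)))"
      using dp by (simp add: sum_ennreal)
    also have "\<dots> \<le> (\<Sum>n. ennreal (diam_pow s (U n)))"
      using that by (intro sum_le_suminf) auto
    also note U(2)
    finally show ?thesis using dp by (subst (asm) ennreal_less_iff) (auto intro: sum_nonneg)
  qed
  then show ?thesis using that U(1) by blast
qed


section \<open>Dimension of systems of weighted cylinders\<close>

lemma sum_UN_le_sum_sum:
  fixes f :: "'b \<Rightarrow> real"
  assumes "finite A" "\<And>a. a \<in> A \<Longrightarrow> finite (B a)" "\<And>x. 0 \<le> f x"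
  shows "sum f (\<Union>a\<in>A. B a) \<le> (\<Sum>a\<in>A. sum f (B a))"
  using assms(1,2)
proof (induction A rule: finite_induct)
  case (insert a A)
  have "sum f (B a \<union> (\<Union>a\<in>A. B a)) + sum f (B a \<inter> (\<Union>a\<in>A. B a)) = sum f (B a) + sum f (\<Union>a\<in>A. B a)"
    using insert by (intro sum.union_inter) auto
  moreover have "0 \<le> sum f (B a \<inter> (\<Union>a\<in>A. B a))" by (intro sum_nonneg assms(3))
  ultimately show ?case using insert by simp
qed simp

text \<open>The metric and combinatorial facts about a conformal system from which the dimension formula
  follows. \<open>W u\<close> stands for \<open>\<parallel>D\<phi>\<^sub>u\<parallel>\<close>. Quasi-multiplicativity is phrased by exchanging the
  beginning \<open>w\<close> of a word for another beginning \<open>w'\<close> of the same length, which avoids weights for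
  words that start at a later level. The packing condition encodes separation: cylinders of one
  level and of size about \<open>\<rho>\<close> are disjoint up to boundary and contain balls of radius comparable to
  \<open>\<rho>\<close>, so a ball of radius \<open>\<rho>\<close> meets a bounded number of them. It is demanded only at comparable
  scales, since a much larger cylinder may enter a ball through an arbitrarily thin cusp.\<close>

locale cylinder_system =
  fixes I :: "nat \<Rightarrow> 'i set" and K :: "'i list \<Rightarrow> 'a::euclidean_space set"
    and W :: "'i list \<Rightarrow> real" and C A c L :: real and N :: nat
  assumes finite_I: "1 \<le> k \<Longrightarrow> finite (I k)"
    and nonempty_I: "1 \<le> k \<Longrightarrow> I k \<noteq> {}"
    and compact_K: "u \<in> words I 1 k \<Longrightarrow> compact (K u)"
    and nonempty_K: "u \<in> words I 1 k \<Longrightarrow> K u \<noteq> {}"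
    and nested_K: "u \<in> words I 1 k \<Longrightarrow> i \<in> I (Suc k) \<Longrightarrow> K (u @ [i]) \<subseteq> K u"
    and W_pos: "u \<in> words I 1 k \<Longrightarrow> 0 < W u"
    and W_le: "u \<in> words I 1 k \<Longrightarrow> W u \<le> A * c ^ k"
    and c: "0 < c" "c < 1"
    and C_pos: "0 < C"
    and quasi_multiplicative:
      "m \<le> n \<Longrightarrow> w \<in> words I 1 m \<Longrightarrow> w' \<in> words I 1 m \<Longrightarrow> v \<in> words I (Suc m) n \<Longrightarrow>
        W (w @ v) * W w' \<le> C * W w * W (w' @ v)"
    and L_pos: "0 < L"
    and diameter_K: "u \<in> words I 1 k \<Longrightarrow> diameter (K u) \<le> L * W u"
    and packing: "0 < \<rho> \<Longrightarrow>
      card {u \<in> words I 1 k. \<rho> < W u \<and> W u \<le> 2 * \<rho> \<and> K u \<inter> ball x \<rho> \<noteq> {}} \<le> N"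
begin

lemma finite_word_set: "finite (words I 1 k)"
  by (rule finite_words[OF finite_I]) auto

lemma word_set_nonempty: "words I 1 k \<noteq> {}"
  by (rule words_nonempty[OF nonempty_I]) auto

definition Z :: "real \<Rightarrow> nat \<Rightarrow> real" where
  "Z t k = (\<Sum>u\<in>words I 1 k. W u powr t)"

definition M :: "nat \<Rightarrow> real" where
  "M k = Max (W ` words I 1 k)"

definition pressure :: "real \<Rightarrow> ereal" where
  "pressure t = liminf (\<lambda>k. ereal (1 / real k * ln (Z t k)))"

lemma Nil_word: "[] \<in> words I 1 0"
  by (simp add: words_def)

lemma A_pos: "0 < A"
  using W_pos[OF Nil_word] W_le[OF Nil_word] by simp

lemma W_le_A: "u \<in> words I 1 k \<Longrightarrow> W u \<le> A"
proof -
  assume u: "u \<in> words I 1 k"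
  have "A * c ^ k \<le> A * 1" using A_pos c by (intro mult_left_mono power_le_one) auto
  then show ?thesis using W_le[OF u] by simp
qed

lemma Z_pos: "0 < Z t k"
  unfolding Z_def using W_pos
  by (intro sum_pos finite_word_set word_set_nonempty) (simp add: less_imp_neq[symmetric])

lemma W_le_M: "u \<in> words I 1 k \<Longrightarrow> W u \<le> M k"
  unfolding M_def using finite_word_set by simp

lemma M_bounds: "0 < M k" "M k \<le> A * c ^ k"
proof -
  have "M k \<in> W ` words I 1 k"
    unfolding M_def using finite_word_set word_set_nonempty by (intro Max_in) auto
  then show "0 < M k" "M k \<le> A * c ^ k" using W_pos W_le by auto
qed

lemma A_c_tendsto_0: "(\<lambda>k. A * c ^ k) \<longlonglongrightarrow> 0"
  using c by (intro tendsto_mult_right_zero LIMSEQ_realpow_zero) auto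

text \<open>Lowering the exponent gains a power of the largest weight. This gain is what absorbs the number
  of children of a cylinder in the lower bound.\<close>

lemma Z_le_M_powr_mult_Z:
  assumes "s \<le> s'"
  shows "Z s' k \<le> M k powr (s' - s) * Z s k"
proof -
  have "W u powr s' \<le> M k powr (s' - s) * W u powr s" if "u \<in> words I 1 k" for u
  proof -
    have "W u powr s' = W u powr (s' - s) * W u powr s"
      by (simp flip: powr_add)
    also have "\<dots> \<le> M k powr (s' - s) * W u powr s"
      using that W_pos[OF that] W_le_M assms by (intro mult_right_mono powr_mono2) auto
    finally show ?thesis .
  qed
  then show ?thesis unfolding Z_def sum_distrib_left by (rule sum_mono)
qed

text \<open>For \<open>t \<le> 0\<close> the weights, which are eventually below 1, contribute at least 1 each.\<close>

lemma pressure_neg_imp_pos: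
  assumes "pressure t < 0"
  shows "0 < t"
proof (rule ccontr)
  assume "\<not> 0 < t"
  have "\<forall>\<^sub>F k in sequentially. A * c ^ k < 1"
    using A_c_tendsto_0 by (rule order_tendstoD) simp
  then have "\<forall>\<^sub>F k in sequentially. 0 \<le> ereal (1 / real k * ln (Z t k))"
  proof eventually_elim
    case (elim k)
    have "1 \<le> W u powr t" if "u \<in> words I 1 k" for u
      using powr_mono2'[of "- t" "W u" 1] powr_mono'[of t 0 "W u"] W_le[OF that] W_pos[OF that] elim \<open>\<not> 0 < t\<close> by simp
    moreover obtain u where "u \<in> words I 1 k" using word_set_nonempty by blast
    moreover from this have "W u powr t \<le> Z t k"
      unfolding Z_def by (intro member_le_sum finite_word_set) auto
    ultimately have "1 \<le> Z t k" by fastforce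
    then show ?case by simp
  qed
  then have "0 \<le> pressure t" unfolding pressure_def by (rule Liminf_bounded)
  then show False using assms by simp
qed

lemma pressure_neg_imp_Z_small:
  assumes "pressure t < 0" "0 < e"
  shows "\<exists>k\<ge>k0. Z t k < e"
proof -
  obtain a where a: "pressure t < ereal a" "a < 0"
    using ereal_dense2[OF assms(1)] by (auto simp: zero_ereal_def)
  have "\<not> (\<forall>\<^sub>F k in sequentially. ereal a \<le> ereal (1 / real k * ln (Z t k)))"
    using a(1) Liminf_bounded[of "ereal a" "\<lambda>k. ereal (1 / real k * ln (Z t k))" sequentially]
    unfolding pressure_def by (auto simp: not_le[symmetric])
  then have freq: "\<exists>k\<ge>k1. 1 / real k * ln (Z t k) < a" for k1
    unfolding eventually_sequentially by (auto simp: not_le)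
  obtain k where k: "k \<ge> max k0 (nat \<lceil>ln e / a\<rceil> + 1)" "1 / real k * ln (Z t k) < a"
    using freq by blast
  have "real k > 0" "ln e / a \<le> real k" using k(1) by linarith+
  then have "ln (Z t k) < a * real k" "a * real k \<le> ln e"
    using k(2) a(2) by (auto simp: field_simps)
  then have "ln (Z t k) < ln e" by simp
  then show ?thesis using Z_pos[of t k] \<open>0 < e\<close> k(1) by (auto intro!: exI[of _ k])
qed

text \<open>Cover the attractor by the cylinders of a level at which the partition sum is small.\<close>

lemma hausdorff_measure_attractor_0:
  assumes "pressure t < 0"
  shows "hausdorff_measure t (attractor I K) = 0"
proof (rule hausdorff_measure_eq_0I)
  fix \<delta> e :: real assume pos: "0 < \<delta>" "0 < e"
  have t: "0 < t" by (rule pressure_neg_imp_pos[OF assms])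
  have "(\<lambda>k. L * (A * c ^ k)) \<longlonglongrightarrow> L * 0"
    by (intro tendsto_intros A_c_tendsto_0)
  then have "\<forall>\<^sub>F k in sequentially. L * (A * c ^ k) < \<delta>"
    using pos by (intro order_tendstoD(2)) auto
  then obtain k0 where k0: "\<And>k. k \<ge> k0 \<Longrightarrow> L * (A * c ^ k) < \<delta>"
    unfolding eventually_sequentially by blast
  obtain k where k: "k \<ge> max 1 k0" "Z t k < e / L powr t"
    using pressure_neg_imp_Z_small[OF assms, of "e / L powr t" "max 1 k0"] pos L_pos by auto
  have "diam_pow t (K u) \<le> L powr t * W u powr t" if u: "u \<in> words I 1 k" for u
  proof -
    have "diam_pow t (K u) \<le> diameter (K u) powr t" using t by (simp add: diam_pow_def)
    also have "\<dots> \<le> (L * W u) powr t"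
      using t u by (intro powr_mono2 diameter_K diameter_ge_0 compact_imp_bounded[OF compact_K]) auto
    finally show ?thesis using L_pos W_pos[OF u] by (simp add: powr_mult)
  qed
  then have "(\<Sum>u\<in>words I 1 k. diam_pow t (K u)) \<le> L powr t * Z t k"
    unfolding Z_def sum_distrib_left by (rule sum_mono)
  also have "\<dots> \<le> e" using k(2) L_pos by (simp add: field_simps)
  finally have "(\<Sum>u\<in>words I 1 k. diam_pow t (K u)) \<le> e" .
  moreover have "bounded (K u) \<and> diameter (K u) \<le> \<delta>" if u: "u \<in> words I 1 k" for u
  proof -
    have "diameter (K u) \<le> L * W u" by (rule diameter_K[OF u])
    also have "\<dots> \<le> L * (A * c ^ k)" using L_pos W_le[OF u] by (intro mult_left_mono) auto
    also have "\<dots> \<le> \<delta>" using k0[of k] k(1) by simp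
    finally show ?thesis using compact_imp_bounded[OF compact_K[OF u]] by simp
  qed
  moreover have "attractor I K \<subseteq> (\<Union>u\<in>words I 1 k. K u)"
    unfolding attractor_def using k(1) by auto
  ultimately show "\<exists>(T :: 'i list set) S. finite T \<and> attractor I K \<subseteq> (\<Union>u\<in>T. S u) \<and>
      (\<forall>u\<in>T. bounded (S u) \<and> diameter (S u) \<le> \<delta>) \<and> (\<Sum>u\<in>T. diam_pow t (S u)) \<le> e"
    using finite_word_set[of k] by (intro exI[of _ "words I 1 k"] exI[of _ K]) blast
qed

text \<open>Below the critical exponent, \<open>Z s k\<close> is at least a fixed negative power of \<open>M k\<close>, while the number
  of symbols is smaller than every negative power of \<open>M k\<close>; so the quotient is at most a positive
  power of \<open>M k\<close>, which decays geometrically.\<close>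

lemma summable_card_div_Z:
  assumes "s < s'" "0 \<le> pressure s'"
    and card_I: "\<And>\<epsilon>. 0 < \<epsilon> \<Longrightarrow> \<forall>\<^sub>F k in sequentially. real (card (I k)) \<le> M k powr (- \<epsilon>)"
  shows "summable (\<lambda>k. real (card (I k)) / Z s k)"
proof -
  \<comment> \<open>of the gap \<open>s' - s = 4\<eta>\<close>, a share \<open>2\<eta>\<close> pays for \<open>card (I k)\<close> and one \<open>\<eta>\<close> for the subexponential
    deviation of \<open>Z s' k\<close> from 1; the last \<open>\<eta>\<close> yields the geometric decay\<close>
  define \<eta> where "\<eta> = (s' - s) / 4"
  have \<eta>: "0 < \<eta>" "s' - s = 4 * \<eta>" using assms(1) by (simp_all add: \<eta>_def)
  have "ereal (\<eta> * ln c) < pressure s'"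
    using \<eta>(1) c assms(2) by (intro less_le_trans[OF _ assms(2)]) (simp add: mult_pos_neg)
  then have "\<forall>\<^sub>F k in sequentially. ereal (\<eta> * ln c) < ereal (1 / real k * ln (Z s' k))"
    unfolding pressure_def by (rule less_LiminfD)
  moreover have "\<forall>\<^sub>F k in sequentially. real (card (I k)) \<le> M k powr (- (2 * \<eta>))"
    using card_I \<eta> by simp
  ultimately have "\<forall>\<^sub>F k in sequentially.
      norm (real (card (I k)) / Z s k) \<le> A powr (2 * \<eta>) * (c powr \<eta>) ^ k"
    using eventually_gt_at_top[of 0]
  proof eventually_elim
    case (elim k)
    have "real k * (\<eta> * ln c) < ln (Z s' k)"
      using elim(1,3) by (simp add: field_simps)
    then have "exp (real k * (\<eta> * ln c)) < Z s' k"
      using Z_pos exp_less_cancel_iff[of "real k * (\<eta> * ln c)" "ln (Z s' k)"] by simp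
    then have "c powr (\<eta> * k) \<le> Z s' k" using c by (simp add: powr_def mult_ac)
    also have "\<dots> \<le> M k powr (4 * \<eta>) * Z s k"
      using Z_le_M_powr_mult_Z[of s s' k] \<eta> assms(1) by simp
    finally have Z: "c powr (\<eta> * k) * M k powr (- (4 * \<eta>)) \<le> Z s k"
      using M_bounds(1)[of k] by (simp add: powr_minus field_simps)
    have "real (card (I k)) / Z s k \<le> M k powr (- (2 * \<eta>)) / (c powr (\<eta> * k) * M k powr (- (4 * \<eta>)))"
      using elim(2) Z M_bounds(1)[of k] c by (intro frac_le) (auto simp: less_imp_neq)
    also have "\<dots> = M k powr (2 * \<eta>) * c powr (- (\<eta> * k))"
      using M_bounds(1)[of k] c by (simp add: powr_minus field_simps flip: powr_add)
    also have "\<dots> \<le> (A * c ^ k) powr (2 * \<eta>) * c powr (- (\<eta> * k))"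
      using M_bounds[of k] \<eta> by (intro mult_right_mono powr_mono2) auto
    also have "\<dots> = A powr (2 * \<eta>) * (c powr (\<eta> * k + \<eta> * k) * c powr (- (\<eta> * k)))"
      using A_pos c by (simp add: powr_mult powr_powr mult_ac flip: powr_realpow)
    also have "\<dots> = A powr (2 * \<eta>) * c powr (\<eta> * k)" by (simp flip: powr_add)
    also have "c powr (\<eta> * k) = (c powr \<eta>) ^ k" using c by (simp add: powr_powr flip: powr_realpow)
    finally show ?case using Z_pos[of s k] by simp
  qed
  moreover have "c powr \<eta> < 1" using c \<eta> by (simp add: powr01_less_one)
  then have "summable (\<lambda>k. A powr (2 * \<eta>) * (c powr \<eta>) ^ k)"
    using c by (intro summable_mult summable_geometric) simp
  ultimately show ?thesis by (rule summable_comparison_test_ev)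
qed

lemma nested_append:
  assumes "w \<in> words I 1 m" "w @ v \<in> words I 1 n" "m \<le> n"
  shows "K (w @ v) \<subseteq> K w"
  using assms(2,3)
proof (induction v arbitrary: n rule: rev_induct)
  case (snoc i v)
  have "length (w @ v @ [i]) = n" "length w = m" using snoc.prems assms(1) by (auto simp: words_def)
  then obtain n' where n': "n = Suc n'" "m \<le> n'" by (cases n) auto
  have "take n' (w @ v @ [i]) \<in> words I 1 n'"
    using words_take[of "w @ v @ [i]" I 1 n n'] snoc.prems n' by simp
  moreover have "take n' (w @ v @ [i]) = w @ v"
    using \<open>length (w @ v @ [i]) = n\<close> n' by simp
  ultimately have wv: "w @ v \<in> words I 1 n'" by simp
  then have "i \<in> I (Suc n')" using words_snoc_iff[of 1 n' "w @ v" I i] snoc.prems n' by simp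
  then have "K ((w @ v) @ [i]) \<subseteq> K (w @ v)" by (rule nested_K[OF wv])
  with snoc.IH[OF wv n'(2)] show ?case by simp
qed simp

text \<open>Cylinders larger than \<open>r\<close> are sorted by dyadic size: those of size about \<open>2\<^sup>j r\<close> that meet
  \<open>ball x r\<close> also meet \<open>ball x (2\<^sup>j r)\<close>, where packing applies. Only logarithmically many sizes
  occur.\<close>

lemma card_large_cylinders:
  assumes "0 < r" "r \<le> A"
  shows "real (card {v \<in> words I 1 k. r < W v \<and> K v \<inter> ball x r \<noteq> {}})
    \<le> real N * (1 + log 2 (A / r))"
proof -
  have step: "card {v \<in> words I 1 k. r < W v \<and> W v \<le> 2 ^ j * r \<and> K v \<inter> ball x r \<noteq> {}} \<le> j * N" for j
  proof (induction j)
    case (Suc j)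
    have "{v \<in> words I 1 k. r < W v \<and> W v \<le> 2 ^ Suc j * r \<and> K v \<inter> ball x r \<noteq> {}} \<subseteq>
        {v \<in> words I 1 k. r < W v \<and> W v \<le> 2 ^ j * r \<and> K v \<inter> ball x r \<noteq> {}} \<union>
        {v \<in> words I 1 k. 2 ^ j * r < W v \<and> W v \<le> 2 * (2 ^ j * r) \<and> K v \<inter> ball x (2 ^ j * r) \<noteq> {}}"
      (is "?S \<subseteq> ?S1 \<union> ?S2")
    proof -
      have "r \<le> 2 ^ j * r" using \<open>0 < r\<close> by simp
      then have "ball x r \<subseteq> ball x (2 ^ j * r)" by (rule subset_ball)
      then show ?thesis by (auto simp: mult.assoc)
    qed
    then have "card ?S \<le> card (?S1 \<union> ?S2)"
      using finite_word_set[of k] by (intro card_mono) auto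
    also have "\<dots> \<le> card ?S1 + card ?S2" by (rule card_Un_le)
    also have "\<dots> \<le> j * N + N" using Suc packing[of "2 ^ j * r" k x] \<open>0 < r\<close> by simp
    finally show ?case by simp
  next
    case 0
    have empty: "{v \<in> words I 1 k. r < W v \<and> W v \<le> 2 ^ 0 * r \<and> K v \<inter> ball x r \<noteq> {}} = {}" by auto
    show ?case unfolding empty by simp
  qed
  define j where "j = nat \<lceil>log 2 (A / r)\<rceil>"
  have pos: "0 \<le> log 2 (A / r)" using assms by simp
  have "A / r = 2 powr (log 2 (A / r))" using assms A_pos by simp
  also have "\<dots> \<le> 2 powr (real j)" unfolding j_def by (intro powr_mono real_nat_ceiling_ge) auto
  finally have "A \<le> 2 ^ j * r" using \<open>0 < r\<close> by (simp add: powr_realpow field_simps)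
  then have "W v \<le> 2 ^ j * r" if "v \<in> words I 1 k" for v using W_le_A[OF that] by simp
  then have "{v \<in> words I 1 k. r < W v \<and> K v \<inter> ball x r \<noteq> {}} =
      {v \<in> words I 1 k. r < W v \<and> W v \<le> 2 ^ j * r \<and> K v \<inter> ball x r \<noteq> {}}" by auto
  then have "card {v \<in> words I 1 k. r < W v \<and> K v \<inter> ball x r \<noteq> {}} \<le> j * N" using step by simp
  then have "real (card {v \<in> words I 1 k. r < W v \<and> K v \<inter> ball x r \<noteq> {}}) \<le> real (j * N)"
    by (rule of_nat_mono)
  also have "\<dots> = real N * real j" by simp
  also have "\<dots> \<le> real N * (1 + log 2 (A / r))"
  proof (rule mult_left_mono)
    have "real j = of_int \<lceil>log 2 (A / r)\<rceil>" using pos unfolding j_def by simp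
    then show "real j \<le> 1 + log 2 (A / r)"
      using of_int_ceiling_le_add_one[of "log 2 (A / r)"] by linarith
  qed simp
  finally show ?thesis .
qed

text \<open>In the distribution that gives a word \<open>u\<close> of length \<open>n\<close> the mass \<open>W u powr s / Z s n\<close>, the
  cylinder of \<open>w\<close> carries mass at most a constant times \<open>W w powr s / Z s m\<close>, independently of
  \<open>n\<close>. This is where quasi-multiplicativity enters: it is summed over all beginnings \<open>w'\<close> and all
  continuations \<open>v\<close>.\<close>

lemma sum_extensions_le:
  assumes "m \<le> n" "w \<in> words I 1 m" "0 \<le> s"
  shows "(\<Sum>u\<in>{u \<in> words I 1 n. take m u = w}. W u powr s) \<le> C powr s * W w powr s * Z s n / Z s m"
proof -
  have fin: "finite (words I (Suc m) n)" by (rule finite_words[OF finite_I]) auto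
  have eq: "(\<Sum>u\<in>{u \<in> words I 1 n. take m u = w}. W u powr s) = (\<Sum>v\<in>words I (Suc m) n. W (w @ v) powr s)"
    unfolding words_extensions[OF assms(1,2)] by (subst sum.reindex) (auto simp: inj_on_def)
  have "(\<Sum>v\<in>words I (Suc m) n. W (w @ v) powr s) * Z s m
      = (\<Sum>w'\<in>words I 1 m. \<Sum>v\<in>words I (Suc m) n. W (w @ v) powr s * W w' powr s)"
    unfolding Z_def by (subst sum.swap) (simp add: sum_product)
  also have "\<dots> \<le> (\<Sum>w'\<in>words I 1 m. \<Sum>v\<in>words I (Suc m) n. C powr s * W w powr s * W (w' @ v) powr s)"
  proof (intro sum_mono)
    fix w' v assume w': "w' \<in> words I 1 m" and v: "v \<in> words I (Suc m) n"
    have pos: "0 < W w" "0 < W w'" "0 < W (w @ v)" "0 < W (w' @ v)"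
      using W_pos w' v assms words_append_iff[of _ I 1 m n v] by auto
    have "(W (w @ v) * W w') powr s \<le> (C * W w * W (w' @ v)) powr s"
      using quasi_multiplicative[OF assms(1,2) w' v] pos \<open>0 \<le> s\<close> by (intro powr_mono2) auto
    then show "W (w @ v) powr s * W w' powr s \<le> C powr s * W w powr s * W (w' @ v) powr s"
      using pos C_pos by (simp add: powr_mult)
  qed
  also have "\<dots> = C powr s * W w powr s * (\<Sum>(w', v)\<in>words I 1 m \<times> words I (Suc m) n. W (w' @ v) powr s)"
    unfolding sum.cartesian_product by (simp add: sum_distrib_left case_prod_beta)
  also have "(\<Sum>(w', v)\<in>words I 1 m \<times> words I (Suc m) n. W (w' @ v) powr s) = Z s n"
    unfolding Z_def
    using sum.reindex_bij_betw[OF bij_betw_words_append[OF assms(1), of I], of "\<lambda>u. W u powr s"]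
    by (simp add: case_prod_beta)
  finally show ?thesis using eq Z_pos[of s m] by (simp add: pos_le_divide_eq)
qed

text \<open>The mass of a ball of radius \<open>r\<close> is at most \<open>H r\<^sup>t\<close>, uniformly in the level \<open>n\<close>. Every word \<open>u\<close>
  counted on the left is cut at the first position where the weight drops to at most \<open>r\<close>. The
  cut words at level \<open>m + 1\<close> are children of cylinders larger than \<open>r\<close> that meet the ball; there are
  at most \<open>N (1 + log (A / r))\<close> such parents, hence at most \<open>card (I (m + 1))\<close> times as many cut
  words, each of mass at most a constant times \<open>r\<^sup>s / Z s (m + 1)\<close>. Summability disposes of the
  levels, and the logarithm is absorbed by passing from \<open>s\<close> to the smaller exponent \<open>t\<close>.\<close>

lemma sum_ball_le:
  assumes "t < s" "0 < s" and summ: "summable (\<lambda>k. real (card (I k)) / Z s k)"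
  shows "\<exists>H>0. \<forall>x r n. 0 < r \<longrightarrow> r < W [] \<longrightarrow> (\<forall>u\<in>words I 1 n. W u \<le> r) \<longrightarrow>
    (\<Sum>u\<in>{u \<in> words I 1 n. K u \<inter> ball x r \<noteq> {}}. W u powr s) \<le> H * r powr t * Z s n"
proof -
  define S where "S = (\<Sum>k. real (card (I (Suc k))) / Z s (Suc k))"
  have summ': "summable (\<lambda>k. real (card (I (Suc k))) / Z s (Suc k))"
    using summ by (subst summable_Suc_iff)
  have partial: "(\<Sum>k<n. real (card (I (Suc k))) / Z s (Suc k)) \<le> S" for n
    unfolding S_def using Z_pos by (intro sum_le_suminf summ') (auto simp: less_imp_le)
  have "0 \<le> S" using partial[of 0] by simp
  define \<delta> where "\<delta> = s - t"
  have \<delta>: "0 < \<delta>" using assms(1) by (simp add: \<delta>_def)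
  \<comment> \<open>the constant from \<open>1 + log 2 y \<le> (1 + 1 / (\<delta> ln 2)) y\<^sup>\<delta>\<close> at \<open>y = A / r \<ge> 1\<close>\<close>
  define B where "B = A powr \<delta> * (1 + 1 / (\<delta> * ln 2))"
  have B: "0 < B" using A_pos \<delta> by (auto simp: B_def intro!: mult_pos_pos add_pos_pos)
  have log_bound: "(1 + log 2 (A / r)) * r powr s \<le> B * r powr t" if r: "0 < r" "r \<le> A" for r
  proof -
    have ge1: "1 \<le> A / r" using r by simp
    have "ln (A / r) \<le> (A / r) powr \<delta> / \<delta>" by (rule ln_powr_bound[OF ge1 \<delta>])
    then have "log 2 (A / r) \<le> (A / r) powr \<delta> / (\<delta> * ln 2)"
      by (simp add: log_def field_simps)
    moreover have "1 \<le> (A / r) powr \<delta>" using ge1 \<delta> by (simp add: ge_one_powr_ge_zero)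
    ultimately have "1 + log 2 (A / r) \<le> (A / r) powr \<delta> * (1 + 1 / (\<delta> * ln 2))"
      by (simp add: distrib_left)
    then have "(1 + log 2 (A / r)) * r powr s \<le> (A / r) powr \<delta> * (1 + 1 / (\<delta> * ln 2)) * r powr s"
      by (intro mult_right_mono) auto
    also have "\<dots> = B * (r powr s / r powr \<delta>)"
      using r A_pos by (simp add: B_def powr_divide)
    also have "r powr s / r powr \<delta> = r powr t" by (simp add: \<delta>_def flip: powr_diff)
    finally show ?thesis .
  qed
  define H where "H = real N * C powr s * B * S + 1"
  have "0 < H" unfolding H_def using B C_pos \<open>0 \<le> S\<close> by (intro add_nonneg_pos mult_nonneg_nonneg) auto
  moreover have "(\<Sum>u\<in>{u \<in> words I 1 n. K u \<inter> ball x r \<noteq> {}}. W u powr s) \<le> H * r powr t * Z s n"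
    if r: "0 < r" "r < W []" and small: "\<forall>u\<in>words I 1 n. W u \<le> r" for x r n
  proof -
    have rA: "r \<le> A" using r W_le_A[OF Nil_word] by simp
    \<comment> \<open>\<open>T m\<close> collects the cut words of length \<open>m + 1\<close>, \<open>P m\<close> their possible parents\<close>
    define P where "P m = {v \<in> words I 1 m. r < W v \<and> K v \<inter> ball x r \<noteq> {}}" for m
    define T where "T m = {w \<in> (\<lambda>(v, i). v @ [i]) ` (P m \<times> I (Suc m)). W w \<le> r}" for m
    have fin_P: "finite (P m)" for m unfolding P_def using finite_word_set by simp
    have fin_T: "finite (T m)" for m unfolding T_def using fin_P finite_I[of "Suc m"] by simp
    have T_words: "w \<in> words I 1 (Suc m)" if "w \<in> T m" for w m
      using that by (auto simp: T_def P_def words_Suc)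
    have card_T: "real (card (T m)) \<le> real N * (1 + log 2 (A / r)) * real (card (I (Suc m)))" for m
    proof -
      have "card (T m) \<le> card ((\<lambda>(v, i). v @ [i]) ` (P m \<times> I (Suc m)))"
        unfolding T_def using fin_P finite_I[of "Suc m"] by (intro card_mono) auto
      also have "\<dots> \<le> card (P m \<times> I (Suc m))"
        using fin_P finite_I[of "Suc m"] by (intro card_image_le) auto
      finally have "real (card (T m)) \<le> real (card (P m)) * real (card (I (Suc m)))"
        by (simp add: card_cartesian_product flip: of_nat_mult)
      also have "\<dots> \<le> real N * (1 + log 2 (A / r)) * real (card (I (Suc m)))"
        unfolding P_def using card_large_cylinders[OF r(1) rA] by (intro mult_right_mono) auto
      finally show ?thesis .
    qed
    have cover: "{u \<in> words I 1 n. K u \<inter> ball x r \<noteq> {}} \<subseteq>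
        (\<Union>m\<in>{..<n}. \<Union>w\<in>T m. {u \<in> words I 1 n. take (Suc m) u = w})"
    proof
      fix u assume "u \<in> {u \<in> words I 1 n. K u \<inter> ball x r \<noteq> {}}"
      then have u: "u \<in> words I 1 n" and Ku: "K u \<inter> ball x r \<noteq> {}" by auto
      have len: "length u = n" using u by (simp add: words_def)
      have take_word: "take m u \<in> words I 1 m" if "m \<le> n" for m
        using words_take[OF u _ that] by simp
      have "W (take n u) \<le> r" using small u len by simp
      then obtain k where k: "k \<le> n" "\<forall>i<k. \<not> W (take i u) \<le> r" "W (take k u) \<le> r"
        using ex_least_nat_le[of "\<lambda>m. W (take m u) \<le> r" n] by blast
      then have "k \<noteq> 0" using r(2) by (intro notI) simp
      then obtain m where m: "k = Suc m" by (cases k) auto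
      have split: "take (Suc m) u = take m u @ [u ! m]"
        using k(1) m len by (simp add: take_Suc_conv_app_nth)
      have "u ! m \<in> I (Suc m)"
        using take_word[of "Suc m"] take_word[of m] words_snoc_iff[of 1 m "take m u" I "u ! m"] split k(1) m
        by simp
      moreover have "take m u \<in> P m"
      proof -
        have "K u \<subseteq> K (take m u)"
          using nested_append[of "take m u" m "drop m u" n] take_word[of m] u k(1) m by simp
        then show ?thesis using Ku k m take_word[of m] by (auto simp: P_def)
      qed
      moreover have "W (take m u @ [u ! m]) \<le> r" using k(3) m split by simp
      ultimately have "take (Suc m) u \<in> T m"
        unfolding T_def split by (auto intro!: image_eqI[of _ _ "(take m u, u ! m)"])
      then show "u \<in> (\<Union>m\<in>{..<n}. \<Union>w\<in>T m. {u \<in> words I 1 n. take (Suc m) u = w})"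
        using u k(1) m by auto
    qed
    have "(\<Sum>u\<in>{u \<in> words I 1 n. K u \<inter> ball x r \<noteq> {}}. W u powr s)
        \<le> (\<Sum>u\<in>(\<Union>m\<in>{..<n}. \<Union>w\<in>T m. {u \<in> words I 1 n. take (Suc m) u = w}). W u powr s)"
      using fin_T finite_word_set[of n] by (intro sum_mono2 cover) auto
    also have "\<dots> \<le> (\<Sum>m<n. \<Sum>u\<in>(\<Union>w\<in>T m. {u \<in> words I 1 n. take (Suc m) u = w}). W u powr s)"
      using fin_T finite_word_set[of n] by (intro sum_UN_le_sum_sum) auto
    also have "\<dots> \<le> (\<Sum>m<n. \<Sum>w\<in>T m. \<Sum>u\<in>{u \<in> words I 1 n. take (Suc m) u = w}. W u powr s)"
      using fin_T finite_word_set[of n] by (intro sum_mono sum_UN_le_sum_sum) auto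
    also have "\<dots> \<le> (\<Sum>m<n. \<Sum>w\<in>T m. C powr s * r powr s * Z s n / Z s (Suc m))"
    proof (intro sum_mono)
      fix m w assume m: "m \<in> {..<n}" and w: "w \<in> T m"
      have "(\<Sum>u\<in>{u \<in> words I 1 n. take (Suc m) u = w}. W u powr s)
          \<le> C powr s * W w powr s * Z s n / Z s (Suc m)"
        using m assms(2) by (intro sum_extensions_le T_words w) auto
      also have "\<dots> \<le> C powr s * r powr s * Z s n / Z s (Suc m)"
        using w W_pos[OF T_words[OF w]] Z_pos[of s n] Z_pos[of s "Suc m"] assms(2)
        by (intro divide_right_mono mult_right_mono mult_left_mono powr_mono2) (auto simp: T_def)
      finally show "(\<Sum>u\<in>{u \<in> words I 1 n. take (Suc m) u = w}. W u powr s)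
          \<le> C powr s * r powr s * Z s n / Z s (Suc m)" .
    qed
    also have "\<dots> = C powr s * r powr s * Z s n * (\<Sum>m<n. real (card (T m)) / Z s (Suc m))"
      by (simp add: sum_distrib_left mult_ac)
    also have "\<dots> \<le> C powr s * r powr s * Z s n *
        (\<Sum>m<n. real N * (1 + log 2 (A / r)) * real (card (I (Suc m))) / Z s (Suc m))"
      using Z_pos by (intro mult_left_mono sum_mono divide_right_mono card_T) (auto simp: less_imp_le)
    also have "\<dots> = C powr s * r powr s * Z s n * (real N * (1 + log 2 (A / r))) *
        (\<Sum>m<n. real (card (I (Suc m))) / Z s (Suc m))"
      by (simp add: sum_distrib_left mult_ac)
    also have "\<dots> \<le> C powr s * r powr s * Z s n * (real N * (1 + log 2 (A / r))) * S"
      using Z_pos[of s n] r(1) rA by (intro mult_left_mono partial mult_nonneg_nonneg) auto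
    also have "\<dots> = real N * C powr s * S * Z s n * ((1 + log 2 (A / r)) * r powr s)"
      by (simp add: mult_ac)
    also have "\<dots> \<le> real N * C powr s * S * Z s n * (B * r powr t)"
      using Z_pos[of s n] \<open>0 \<le> S\<close> by (intro mult_left_mono log_bound r(1) rA) auto
    also have "\<dots> = (H - 1) * r powr t * Z s n" by (simp add: H_def mult_ac)
    also have "\<dots> \<le> H * r powr t * Z s n"
      using Z_pos[of s n] by (intro mult_right_mono) auto
    finally show ?thesis .
  qed
  ultimately show ?thesis by blast
qed

lemma compact_level: "compact (\<Union>u\<in>words I 1 k. K u)"
  using finite_word_set compact_K by (intro compact_UN) auto

lemma level_antimono:
  assumes "m \<le> n"
  shows "(\<Union>u\<in>words I 1 n. K u) \<subseteq> (\<Union>u\<in>words I 1 m. K u)"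
proof
  fix x assume "x \<in> (\<Union>u\<in>words I 1 n. K u)"
  then obtain u where u: "u \<in> words I 1 n" "x \<in> K u" by blast
  have "take m u \<in> words I 1 m" using words_take[OF u(1) _ assms] by simp
  moreover from this have "K u \<subseteq> K (take m u)"
    using nested_append[of "take m u" m "drop m u" n] u(1) assms by simp
  ultimately show "x \<in> (\<Union>u\<in>words I 1 m. K u)" using u(2) by blast
qed

lemma level_subset_open:
  assumes "open G" "attractor I K \<subseteq> G"
  shows "\<exists>k0\<ge>1. \<forall>k\<ge>k0. (\<Union>u\<in>words I 1 k. K u) \<subseteq> G"
proof (rule ccontr)
  assume neg: "\<not> ?thesis"
  let ?F = "\<lambda>k. (\<Union>u\<in>words I 1 (Suc k). K u) - G"
  have "?F k \<noteq> {}" for k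
  proof
    assume "?F k = {}"
    then have "(\<Union>u\<in>words I 1 k'. K u) \<subseteq> G" if "k' \<ge> Suc k" for k'
      using level_antimono[OF that] by blast
    then show False using neg by (metis One_nat_def le_add1 plus_1_eq_Suc)
  qed
  moreover have "compact (?F k)" for k using compact_level assms(1) by (rule compact_diff)
  moreover have "?F n \<subseteq> ?F m" if "m \<le> n" for m n
    using level_antimono[of "Suc m" "Suc n"] that by blast
  ultimately have "\<Inter>(range ?F) \<noteq> {}" by (intro compact_nest) auto
  then obtain x where x: "\<And>k. x \<in> ?F k" by blast
  have "x \<in> attractor I K"
    unfolding attractor_def
  proof
    fix k :: nat assume "k \<in> {1..}"
    then show "x \<in> (\<Union>u\<in>words I 1 k. K u)" using x[of "k - 1"] by simp
  qed
  then show False using x[of 0] assms(2) by blast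
qed

text \<open>The mass distribution principle, applied to the distributions on finite levels in place of a limit
  measure. A cheap cover of the attractor is fattened to balls and reduced to a finite
  one, which then covers all cylinders of some level; the ball estimate at that level bounds its
  cost from below. Fattening costs little because \<open>D powr t \<le> diam_pow \<sigma> U\<close> for sets of diameter
  \<open>D < 1\<close>, including the cases of a point and of \<open>\<sigma> = 0\<close>.\<close>

lemma hausdorff_measure_attractor_pos:
  assumes "0 \<le> \<sigma>" "\<sigma> < t" "t < s"
    and summ: "summable (\<lambda>k. real (card (I k)) / Z s k)"
  shows "hausdorff_measure \<sigma> (attractor I K) \<noteq> 0"
proof
  assume zero: "hausdorff_measure \<sigma> (attractor I K) = 0"
  obtain H where H: "0 < H" and ball: "\<And>x r n. 0 < r \<Longrightarrow> r < W [] \<Longrightarrow> (\<forall>u\<in>words I 1 n. W u \<le> r) \<Longrightarrow>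
    (\<Sum>u\<in>{u \<in> words I 1 n. K u \<inter> ball x r \<noteq> {}}. W u powr s) \<le> H * r powr t * Z s n"
  proof -
    have "0 < s" using assms by linarith
    show ?thesis using sum_ball_le[OF assms(3) \<open>0 < s\<close> summ] that by blast
  qed
  \<comment> \<open>the cover costs at most \<open>e\<close> and its fattening at most \<open>2e\<close>, and \<open>3 H e < 1\<close>\<close>
  define e where "e = 1 / (4 * H)"
  have "0 < e" using H by (simp add: e_def)
  define \<delta> where "\<delta> = min 1 (W []) / 2"
  have \<delta>: "0 < \<delta>" "\<delta> < 1" "\<delta> < W []" using W_pos[OF Nil_word] by (auto simp: \<delta>_def min_def)
  obtain U where U: "U \<in> delta_covers \<delta> (attractor I K)"
    "\<And>F. finite F \<Longrightarrow> (\<Sum>n\<in>F. diam_pow \<sigma> (U n)) \<le> e"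
    using hausdorff_measure_0_cover[OF zero \<delta>(1) \<open>0 < e\<close>] by blast
  have U_cover: "attractor I K \<subseteq> (\<Union>n. U n)" and U_bd: "\<And>n. bounded (U n)" "\<And>n. diameter (U n) \<le> \<delta>"
    using U(1) by (auto simp: delta_covers_def)
  have "\<exists>r. diameter (U n) < r \<and> r < W [] \<and> r powr t \<le> diam_pow \<sigma> (U n) + e * (1 / 2) ^ n" for n
  proof -
    let ?D = "diameter (U n)"
    have D: "0 \<le> ?D" "?D < 1" "?D < W []" using U_bd[of n] \<delta> diameter_ge_0 by (auto intro: le_less_trans)
    have "?D powr t \<le> diam_pow \<sigma> (U n)"
      using D assms(1,2) by (auto simp: diam_pow_def intro: powr_mono' powr_le1)
    also have "\<dots> < diam_pow \<sigma> (U n) + e * (1 / 2) ^ n" using \<open>0 < e\<close> by simp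
    finally have lt: "?D powr t < diam_pow \<sigma> (U n) + e * (1 / 2) ^ n" .
    have "((\<lambda>r. r powr t) \<longlongrightarrow> ?D powr t) (at_right ?D)"
      using D(1) assms(1,2) by (intro tendsto_powr') (auto intro: tendsto_intros eventually_at_rightI[of _ "?D + 1"])
    then have "\<forall>\<^sub>F r in at_right ?D. r powr t < diam_pow \<sigma> (U n) + e * (1 / 2) ^ n"
      using lt by (rule order_tendstoD(2))
    moreover have "\<forall>\<^sub>F r in at_right ?D. r < W []"
      by (rule order_tendstoD(2)[OF tendsto_ident_at D(3)])
    moreover have "\<forall>\<^sub>F r in at_right ?D. ?D < r" by (rule eventually_at_right_less)
    ultimately have "\<forall>\<^sub>F r in at_right ?D. ?D < r \<and> r < W [] \<and> r powr t \<le> diam_pow \<sigma> (U n) + e * (1 / 2) ^ n"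
      by eventually_elim auto
    then show ?thesis using eventually_happens'[of "at_right ?D"] by force
  qed
  then obtain r where r: "\<And>n. diameter (U n) < r n" "\<And>n. r n < W []"
    "\<And>n. r n powr t \<le> diam_pow \<sigma> (U n) + e * (1 / 2) ^ n"
    by metis
  have r_pos: "0 < r n" for n using r(1)[of n] diameter_ge_0[OF U_bd(1)[of n]] by simp
  define p where "p n = (SOME y. y \<in> U n)" for n
  have U_ball: "U n \<subseteq> ball (p n) (r n)" for n
  proof
    fix y assume y: "y \<in> U n"
    then have "p n \<in> U n" unfolding p_def by (rule someI)
    then have "dist (p n) y \<le> diameter (U n)" using y by (rule diameter_bounded_bound[OF U_bd(1)])
    then show "y \<in> ball (p n) (r n)" using r(1)[of n] by simp
  qed
  have cpt: "compact (attractor I K)"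
  proof -
    have "attractor I K = (\<Union>u\<in>words I 1 1. K u) \<inter> (\<Inter>k\<in>{1..}. \<Union>u\<in>words I 1 k. K u)"
      unfolding attractor_def by auto
    then show ?thesis
      using compact_level compact_imp_closed by (metis closed_INT compact_Int_closed)
  qed
  have cov: "attractor I K \<subseteq> (\<Union>n\<in>UNIV. ball (p n) (r n))" using U_cover U_ball by blast
  obtain F where F: "finite F" "attractor I K \<subseteq> (\<Union>n\<in>F. ball (p n) (r n))"
    by (rule compactE_image[OF cpt _ cov]) auto
  obtain k0 where k0: "\<And>k. k \<ge> k0 \<Longrightarrow> (\<Union>u\<in>words I 1 k. K u) \<subseteq> (\<Union>n\<in>F. ball (p n) (r n))"
    using level_subset_open[OF _ F(2)] by blast
  have "\<forall>\<^sub>F k in sequentially. \<forall>n\<in>F. A * c ^ k < r n"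
    using F(1) order_tendstoD(2)[OF A_c_tendsto_0 r_pos] by (intro eventually_ball_finite) auto
  then obtain k where k: "k \<ge> k0" "\<And>n. n \<in> F \<Longrightarrow> A * c ^ k < r n"
    unfolding eventually_sequentially by (meson max.cobounded1 max.cobounded2)
  have cover: "words I 1 k \<subseteq> (\<Union>n\<in>F. {u \<in> words I 1 k. K u \<inter> ball (p n) (r n) \<noteq> {}})"
    using k0[OF k(1)] nonempty_K by fastforce
  have "Z s k \<le> (\<Sum>u\<in>(\<Union>n\<in>F. {u \<in> words I 1 k. K u \<inter> ball (p n) (r n) \<noteq> {}}). W u powr s)"
    unfolding Z_def using F(1) finite_word_set[of k] by (intro sum_mono2 cover) auto
  also have "\<dots> \<le> (\<Sum>n\<in>F. \<Sum>u\<in>{u \<in> words I 1 k. K u \<inter> ball (p n) (r n) \<noteq> {}}. W u powr s)"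
    using F(1) finite_word_set[of k] by (intro sum_UN_le_sum_sum) auto
  also have "\<dots> \<le> (\<Sum>n\<in>F. H * r n powr t * Z s k)"
  proof (intro sum_mono ball r_pos r(2) ballI)
    fix n u assume "n \<in> F" "u \<in> words I 1 k"
    then show "W u \<le> r n" using W_le[of u k] k(2)[of n] by simp
  qed
  also have "\<dots> = H * Z s k * (\<Sum>n\<in>F. r n powr t)" by (simp add: sum_distrib_left mult_ac)
  finally have "1 \<le> H * (\<Sum>n\<in>F. r n powr t)" using Z_pos[of s k] by (simp add: mult_ac)
  also have "\<dots> \<le> H * (\<Sum>n\<in>F. diam_pow \<sigma> (U n) + e * (1 / 2) ^ n)"
    using H by (intro mult_left_mono sum_mono r(3)) auto
  also have "\<dots> = H * ((\<Sum>n\<in>F. diam_pow \<sigma> (U n)) + e * (\<Sum>n\<in>F. (1 / 2) ^ n))"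
    by (simp add: sum.distrib sum_distrib_left)
  also have "\<dots> \<le> H * (e + e * 2)"
  proof -
    have "(\<Sum>n\<in>F. (1 / 2 :: real) ^ n) \<le> (\<Sum>n. (1 / 2) ^ n)"
      using F(1) by (intro sum_le_suminf summable_geometric) auto
    also have "\<dots> = 2" by (subst suminf_geometric) auto
    finally show ?thesis using H \<open>0 < e\<close> U(2)[OF F(1)] by (intro mult_left_mono add_mono) auto
  qed
  also have "\<dots> < 1" using H by (simp add: e_def)
  finally show False by simp
qed

text \<open>The lower bound spends three gaps \<open>\<sigma> < t < s < s'\<close> below the critical value: from \<open>s'\<close> to \<open>s\<close>
  to absorb the number of children, from \<open>s\<close> to \<open>t\<close> to absorb a logarithm, and from \<open>t\<close> to \<open>\<sigma>\<close> so
  that \<open>t > 0\<close> even when \<open>\<sigma> = 0\<close>.\<close>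

theorem hausdorff_dim_attractor:
  assumes card_I: "\<And>\<epsilon>. 0 < \<epsilon> \<Longrightarrow> \<forall>\<^sub>F k in sequentially. real (card (I k)) \<le> M k powr (- \<epsilon>)"
  shows "hausdorff_dim (attractor I K) = Inf {ereal t | t. pressure t < 0}"
proof (rule antisym)
  show "hausdorff_dim (attractor I K) \<le> Inf {ereal t | t. pressure t < 0}"
    unfolding hausdorff_dim_def
    using pressure_neg_imp_pos hausdorff_measure_attractor_0
    by (intro Inf_superset_mono) (auto intro: less_imp_le)
  show "Inf {ereal t | t. pressure t < 0} \<le> hausdorff_dim (attractor I K)"
    unfolding hausdorff_dim_def
  proof (rule Inf_greatest, clarify)
    fix \<sigma> :: real assume \<sigma>: "0 \<le> \<sigma>" "hausdorff_measure \<sigma> (attractor I K) = 0"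
    show "Inf {ereal t | t. pressure t < 0} \<le> ereal \<sigma>"
    proof (rule ccontr)
      assume "\<not> Inf {ereal t | t. pressure t < 0} \<le> ereal \<sigma>"
      then obtain s' where s': "\<sigma> < s'" "ereal s' < Inf {ereal t | t. pressure t < 0}"
        using ereal_dense2[of "ereal \<sigma>"] by (auto simp: not_le)
      have "0 \<le> pressure s'"
      proof (rule ccontr)
        assume "\<not> 0 \<le> pressure s'"
        then have "Inf {ereal t | t. pressure t < 0} \<le> ereal s'"
          by (intro Inf_lower) (auto simp: not_le)
        then show False using s'(2) by simp
      qed
      moreover obtain s where s: "\<sigma> < s" "s < s'" using dense[OF s'(1)] by blast
      moreover obtain t where t: "\<sigma> < t" "t < s" using dense[OF s(1)] by blast
      ultimately have "hausdorff_measure \<sigma> (attractor I K) \<noteq> 0"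
        using \<sigma>(1) card_I by (intro hausdorff_measure_attractor_pos[of \<sigma> t s] summable_card_div_Z[of s s']) auto
      then show False using \<sigma>(2) by simp
    qed
  qed
qed

end


section \<open>Conformal maps\<close>

text \<open>The segment between two points of \<open>S\<close> may leave \<open>V\<close>, so the mean value inequality does not
  apply directly. But "the increment of every such map between \<open>x\<close> and \<open>y\<close> is at most a constant
  multiple of its derivative bound" is an equivalence relation in \<open>x\<close> and \<open>y\<close> that holds inside
  small balls; connectedness of \<open>V\<close> makes it hold everywhere, and compactness of \<open>S\<close> makes the
  constant uniform. That the constant does not depend on the map is the point: it bounds the
  diameters of all cylinders at once.\<close>

lemma uniform_mean_value_on_compact:
  fixes V S :: "'a::euclidean_space set"
  assumes "open V" "connected V" "compact S" "S \<subseteq> V"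
  shows "\<exists>L>0. \<forall>(f :: 'a \<Rightarrow> 'b::real_normed_vector) f' B.
           (\<forall>z\<in>V. (f has_derivative f' z) (at z) \<and> onorm (f' z) \<le> B) \<longrightarrow>
           (\<forall>x\<in>S. \<forall>y\<in>S. norm (f x - f y) \<le> L * B)"
proof (cases "S = {}")
  case True
  then show ?thesis by (intro exI[of _ 1]) auto
next
  case False
  define adm where "adm f f' B \<longleftrightarrow> (\<forall>z\<in>V. (f has_derivative f' z) (at z) \<and> onorm (f' z) \<le> B)"
    for f :: "'a \<Rightarrow> 'b" and f' B
  define R where "R x y \<longleftrightarrow> (\<exists>L. \<forall>f f' B. adm f f' B \<longrightarrow> norm (f x - f y) \<le> L * B)" for x y
  have local: "norm (f y - f x) \<le> e * B"
    if "adm f f' B" "ball x e \<subseteq> V" "y \<in> ball x e" for f f' B x y e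
  proof -
    have e: "0 < e" using that(3) by (auto simp: dist_norm intro: le_less_trans[OF norm_ge_zero])
    have "0 \<le> B"
      using that e onorm_pos_le[OF has_derivative_bounded_linear] unfolding adm_def
      by (meson centre_in_ball order_trans subsetD)
    have "(f has_derivative f' z) (at z within ball x e)" "onorm (f' z) \<le> B" if "z \<in> ball x e" for z
      using that \<open>adm f f' B\<close> \<open>ball x e \<subseteq> V\<close> has_derivative_at_withinI
      unfolding adm_def by blast+
    then have "norm (f y - f x) \<le> B * norm (y - x)"
      using differentiable_bound[of "ball x e" f f' B y x] that(3) e by simp
    also have "\<dots> \<le> B * e"
      using that(3) \<open>0 \<le> B\<close> by (intro mult_left_mono) (auto simp: dist_norm norm_minus_commute)
    finally show ?thesis by (simp add: mult.commute)
  qed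
  have R: "R a b" if "a \<in> V" "b \<in> V" for a b
  proof (rule connected_equivalence_relation[OF \<open>connected V\<close> that])
    show "R y x" if "R x y" for x y using that by (simp add: R_def norm_minus_commute)
    show "R x z" if xyz: "R x y" "R y z" for x y z
    proof -
      obtain L1 L2 where
        "\<forall>f f' B. adm f f' B \<longrightarrow> norm (f x - f y) \<le> L1 * B"
        "\<forall>f f' B. adm f f' B \<longrightarrow> norm (f y - f z) \<le> L2 * B"
        using xyz unfolding R_def by blast
      then have "norm (f x - f y) + norm (f y - f z) \<le> (L1 + L2) * B" if "adm f f' B" for f f' B
        using that by (auto simp: distrib_right intro: add_mono)
      moreover have "norm (f x - f z) \<le> norm (f x - f y) + norm (f y - f z)" for f :: "'a \<Rightarrow> 'b"
        using norm_triangle_ineq[of "f x - f y" "f y - f z"] by simp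
      ultimately have "norm (f x - f z) \<le> (L1 + L2) * B" if "adm f f' B" for f f' B
        using that order_trans by blast
      then show ?thesis unfolding R_def by blast
    qed
    show "\<exists>T. openin (top_of_set V) T \<and> x \<in> T \<and> (\<forall>y\<in>T. R x y)" if x: "x \<in> V" for x
    proof -
      obtain e where e: "e > 0" "ball x e \<subseteq> V" using \<open>open V\<close> x openE by blast
      have "R x y" if "y \<in> ball x e" for y
        unfolding R_def using local[OF _ e(2) that] by (metis norm_minus_commute)
      then show ?thesis
        by (intro exI[of _ "ball x e"]) (use e in \<open>auto simp: openin_open_eq[OF \<open>open V\<close>]\<close>)
    qed
  qed
  obtain x0 where "x0 \<in> S" using False by blast
  have "\<exists>e>0. ball y e \<subseteq> V" if "y \<in> S" for y
    using that assms openE by blast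
  then obtain e where e: "\<And>y. y \<in> S \<Longrightarrow> 0 < e y \<and> ball y (e y) \<subseteq> V" by metis
  have "\<exists>L. \<forall>f f' B. adm f f' B \<longrightarrow> norm (f y - f x0) \<le> L * B" if "y \<in> S" for y
    using R[of y x0] that \<open>x0 \<in> S\<close> assms(4) unfolding R_def by blast
  then obtain L where L: "\<And>y f f' B. y \<in> S \<Longrightarrow> adm f f' B \<Longrightarrow> norm (f y - f x0) \<le> L y * B"
    by metis
  obtain D where D: "D \<subseteq> S" "finite D" "S \<subseteq> (\<Union>y\<in>D. ball y (e y))"
    by (rule compactE_image[OF \<open>compact S\<close>, of S "\<lambda>y. ball y (e y)"]) (use e in force)+
  define L' where "L' = (\<Sum>y\<in>D. \<bar>L y\<bar> + e y) + 1"
  have e_D: "0 \<le> \<bar>L y\<bar> + e y" if "y \<in> D" for y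
    using e[of y] that D(1) by (auto simp: add_nonneg_pos less_imp_le)
  have "norm (f z - f x0) \<le> L' * B" if zS: "z \<in> S" and fB: "adm f f' B" for z f f' B
  proof -
    obtain y where y: "y \<in> D" "z \<in> ball y (e y)" using D zS by blast
    have yS: "y \<in> S" using y D by blast
    have B: "0 \<le> B"
      using zS fB assms onorm_pos_le[OF has_derivative_bounded_linear] unfolding adm_def
      by (meson order_trans subsetD)
    have "norm (f z - f x0) \<le> norm (f z - f y) + norm (f y - f x0)"
      using norm_triangle_ineq[of "f z - f y" "f y - f x0"] by simp
    also have "\<dots> \<le> e y * B + L y * B"
      using local[OF fB _ y(2)] e[OF yS] L[OF yS fB] by (intro add_mono) auto
    also have "\<dots> = (L y + e y) * B" by (simp add: algebra_simps)
    also have "\<dots> \<le> (\<bar>L y\<bar> + e y) * B" using B by (intro mult_right_mono) auto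
    also have "\<dots> \<le> L' * B"
    proof (rule mult_right_mono[OF _ B])
      have "\<bar>L y\<bar> + e y \<le> (\<Sum>y\<in>D. \<bar>L y\<bar> + e y)"
        using y D e_D by (intro member_le_sum) auto
      then show "\<bar>L y\<bar> + e y \<le> L'" by (simp add: L'_def)
    qed
    finally show ?thesis .
  qed
  then have near: "norm (f x - f x0) + norm (f y - f x0) \<le> (2 * L') * B"
    if "x \<in> S" "y \<in> S" "adm f f' B" for x y f f' B
    using add_mono[of "norm (f x - f x0)" "L' * B" "norm (f y - f x0)" "L' * B"] that by (simp add: mult.commute mult.left_commute)
  have "norm (f x - f y) \<le> (2 * L') * B" if "x \<in> S" "y \<in> S" "adm f f' B" for x y f f' B
    using norm_triangle_ineq4[of "f x - f x0" "f y - f x0"] near[OF that] by simp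
  moreover have "L' > 0"
    unfolding L'_def using e_D by (intro add_nonneg_pos sum_nonneg) auto
  ultimately show ?thesis unfolding adm_def
    by (intro exI[of _ "2 * L'"]) auto
qed

lemma similarity_linear_scaling_factor:
  fixes T :: "'a::euclidean_space \<Rightarrow> 'a"
  assumes "similarity_linear T"
  shows "0 < scaling_factor T" "norm (T v) = scaling_factor T * norm v"
proof -
  obtain r where r: "r > 0" "\<forall>v. norm (T v) = r * norm v"
    using assms unfolding similarity_linear_def by blast
  obtain b :: 'a where "b \<in> Basis" by (meson all_not_in_conv nonempty_Basis)
  have "scaling_factor T = r"
    unfolding scaling_factor_def
    by (rule the_equality) (use r \<open>b \<in> Basis\<close> in \<open>auto dest!: spec[of _ b]\<close>)
  with r show "0 < scaling_factor T" "norm (T v) = scaling_factor T * norm v" by auto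
qed

text \<open>The part of being a conformal diffeomorphism into \<open>V\<close> that the dimension estimates rely on; in
  this form stability under composition is immediate from the chain rule.\<close>

definition injective_conformal :: "'a::euclidean_space set \<Rightarrow> ('a \<Rightarrow> 'a) \<Rightarrow> bool" where
  "injective_conformal V f \<longleftrightarrow> f ` V \<subseteq> V \<and> inj_on f V \<and>
     (\<forall>x\<in>V. f differentiable (at x) \<and> similarity_linear (frechet_derivative f (at x)))"

lemma injective_conformal_derivative:
  assumes "injective_conformal V f" "x \<in> V"
  shows "(f has_derivative frechet_derivative f (at x)) (at x)"
    and "linear (frechet_derivative f (at x))"
    and "0 < D_scale f x"
    and "norm (frechet_derivative f (at x) v) = D_scale f x * norm v"
proof -
  have "f differentiable (at x)" and sim: "similarity_linear (frechet_derivative f (at x))"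
    using assms unfolding injective_conformal_def by auto
  then show "(f has_derivative frechet_derivative f (at x)) (at x)"
    "linear (frechet_derivative f (at x))"
    by (simp_all add: frechet_derivative_works[symmetric] similarity_linear_def)
  show "0 < D_scale f x" "norm (frechet_derivative f (at x) v) = D_scale f x * norm v"
    unfolding D_scale_def using similarity_linear_scaling_factor[OF sim] by blast+
qed

lemma onorm_frechet_derivative:
  assumes "injective_conformal V f" "x \<in> V"
  shows "onorm (frechet_derivative f (at x)) \<le> D_scale f x"
  using injective_conformal_derivative[OF assms]
  by (intro onorm_bound) auto

lemma D_scale_eqI:
  fixes f :: "'a::euclidean_space \<Rightarrow> 'a"
  assumes "(f has_derivative f') (at x)" "\<And>v. norm (f' v) = r * norm v"
  shows "D_scale f x = r"
proof -
  obtain b :: 'a where "b \<in> Basis" by (meson all_not_in_conv nonempty_Basis)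
  have "frechet_derivative f (at x) = f'"
    using assms(1) by (rule frechet_derivative_at[symmetric])
  moreover have "scaling_factor f' = r"
    unfolding scaling_factor_def
    by (rule the_equality) (use assms(2) \<open>b \<in> Basis\<close> in \<open>auto dest!: spec[of _ b]\<close>)
  ultimately show ?thesis by (simp add: D_scale_def)
qed

lemma D_scale_id: "D_scale id (x :: 'a::euclidean_space) = 1"
  by (rule D_scale_eqI[of _ "\<lambda>v. v"]) (auto simp: id_def intro!: derivative_intros)

lemma D_scale_comp:
  assumes "injective_conformal V f" "injective_conformal V g" "x \<in> V"
  shows "D_scale (f \<circ> g) x = D_scale f (g x) * D_scale g x"
proof -
  have gx: "g x \<in> V" using assms unfolding injective_conformal_def by blast
  show ?thesis
    by (rule D_scale_eqI[OF diff_chain_at[OF injective_conformal_derivative(1)[OF assms(2,3)]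
            injective_conformal_derivative(1)[OF assms(1) gx]]])
      (simp add: injective_conformal_derivative(4)[OF assms(1) gx]
        injective_conformal_derivative(4)[OF assms(2,3)])
qed

lemma injective_conformal_id: "injective_conformal V id"
  by (auto simp: injective_conformal_def similarity_linear_def id_def frechet_derivative_ident linear_id[unfolded id_def]
      intro: exI[of _ 1])

lemma injective_conformal_comp:
  assumes "injective_conformal V f" "injective_conformal V g"
  shows "injective_conformal V (f \<circ> g)"
proof -
  have "(f \<circ> g) differentiable (at x) \<and> similarity_linear (frechet_derivative (f \<circ> g) (at x))"
    if x: "x \<in> V" for x
  proof -
    have gx: "g x \<in> V" using assms x unfolding injective_conformal_def by blast
    note df = injective_conformal_derivative[OF assms(1) gx]
    note dg = injective_conformal_derivative[OF assms(2) x]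
    have d: "(f \<circ> g has_derivative frechet_derivative f (at (g x)) \<circ> frechet_derivative g (at x)) (at x)"
      by (rule diff_chain_at[OF dg(1) df(1)])
    have eq: "frechet_derivative (f \<circ> g) (at x)
        = frechet_derivative f (at (g x)) \<circ> frechet_derivative g (at x)"
      using d by (rule frechet_derivative_at[symmetric])
    have "similarity_linear (frechet_derivative f (at (g x)) \<circ> frechet_derivative g (at x))"
      unfolding similarity_linear_def using df dg
      by (auto intro!: linear_compose exI[of _ "D_scale f (g x) * D_scale g x"])
    then show ?thesis using d eq by (auto simp: differentiable_def)
  qed
  moreover have "inj_on (f \<circ> g) V"
    using assms unfolding injective_conformal_def by (blast intro: comp_inj_on inj_on_subset)
  moreover have "(f \<circ> g) ` V \<subseteq> V"
    using assms unfolding injective_conformal_def image_comp[symmetric] by blast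
  ultimately show ?thesis unfolding injective_conformal_def by blast
qed

text \<open>Let \<open>m\<close> be the distance from \<open>f a\<close> to the image of the sphere of radius \<open>\<rho>\<close>. The ball of radius
  \<open>m\<close> about \<open>f a\<close> is connected and misses the frontier of the open set \<open>f ` ball a \<rho>\<close>, so it lies
  inside. This ball is convex and the inverse of \<open>f\<close> has Lipschitz constant \<open>1 / \<kappa>\<close> on it; following
  the inverse up to a nearest point of the image of the sphere gives \<open>\<rho> \<le> m / \<kappa>\<close>.\<close>

lemma ball_subset_conformal_image:
  fixes f :: "'a::euclidean_space \<Rightarrow> 'a"
  assumes f: "injective_conformal V f" and "open V" and V: "cball a \<rho> \<subseteq> V" and "0 < \<rho>" "0 < \<kappa>"
    and scale: "\<And>x. x \<in> V \<Longrightarrow> \<kappa> \<le> D_scale f x"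
  shows "ball (f a) (\<kappa> * \<rho>) \<subseteq> f ` ball a \<rho>"
proof -
  have inj: "inj_on f V" using f unfolding injective_conformal_def by blast
  have cont: "continuous_on V f"
    using injective_conformal_derivative(1)[OF f]
    by (meson continuous_at_imp_continuous_on has_derivative_continuous)
  have aV: "a \<in> V" using V \<open>0 < \<rho>\<close> by auto
  have ballV: "ball a \<rho> \<subseteq> V" using V ball_subset_cball by blast
  have "sphere a \<rho> \<noteq> {}" using \<open>0 < \<rho>\<close> by simp
  moreover have "continuous_on (sphere a \<rho>) (\<lambda>x. dist (f a) (f x))"
    using V by (intro continuous_intros continuous_on_subset[OF cont]) auto
  ultimately obtain b where b: "b \<in> sphere a \<rho>" and
    bmin: "\<And>x. x \<in> sphere a \<rho> \<Longrightarrow> dist (f a) (f b) \<le> dist (f a) (f x)"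
    using continuous_attains_inf[of "sphere a \<rho>" "\<lambda>x. dist (f a) (f x)"] by auto
  define m where "m = dist (f a) (f b)"
  have bV: "b \<in> V" using b V by auto
  have ab: "dist a b = \<rho>" using b by auto
  have fab: "f a \<noteq> f b" using inj_on_eq_iff[OF inj aV bV] ab \<open>0 < \<rho>\<close> by auto
  have open_image: "open (f ` ball a \<rho>)"
    by (intro invariance_of_domain continuous_on_subset[OF cont] inj_on_subset[OF inj] ballV) auto
  have sub: "ball (f a) m \<subseteq> f ` ball a \<rho>"
  proof (rule ccontr)
    assume "\<not> ball (f a) m \<subseteq> f ` ball a \<rho>"
    moreover have "f a \<in> ball (f a) m" "f a \<in> f ` ball a \<rho>"
      using fab \<open>0 < \<rho>\<close> by (simp_all add: m_def)
    then have "ball (f a) m \<inter> f ` ball a \<rho> \<noteq> {}" by blast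
    ultimately have "ball (f a) m \<inter> frontier (f ` ball a \<rho>) \<noteq> {}"
      by (intro connected_Int_frontier connected_ball) auto
    then obtain y where y: "dist (f a) y < m" "y \<in> frontier (f ` ball a \<rho>)" by auto
    have "compact (f ` cball a \<rho>)"
      using V by (intro compact_continuous_image continuous_on_subset[OF cont]) auto
    then have "closure (f ` ball a \<rho>) \<subseteq> f ` cball a \<rho>"
      by (intro closure_minimal) (auto intro: compact_imp_closed)
    moreover have "y \<in> closure (f ` ball a \<rho>) - f ` ball a \<rho>"
      using y(2) open_image by (simp add: frontier_def interior_open)
    ultimately obtain x where "x \<in> cball a \<rho>" "x \<notin> ball a \<rho>" "y = f x" by blast
    then have "x \<in> sphere a \<rho>" "y = f x" by auto
    then show False using bmin[of x] y(1) by (simp add: m_def)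
  qed
  define g where "g = inv_into V f"
  have gf: "g (f x) = x" if "x \<in> V" for x
    using that inj by (simp add: g_def)
  have dg: "(g has_derivative inv (frechet_derivative f (at x))) (at (f x)) \<and>
      onorm (inv (frechet_derivative f (at x))) \<le> 1 / \<kappa>" if x: "x \<in> V" for x
  proof -
    let ?T = "frechet_derivative f (at x)"
    note df = injective_conformal_derivative[OF f x]
    have "inj ?T"
      using df(3,4) unfolding linear_injective_0[OF df(2)] by (metis less_numeral_extra(3) mult_eq_0_iff norm_eq_zero)
    then have surj: "surj ?T" using df(2) linear_injective_imp_surjective by blast
    have "norm (inv ?T v) \<le> 1 / \<kappa> * norm v" for v
    proof -
      have "norm v = D_scale f x * norm (inv ?T v)"
        using df(4)[of "inv ?T v"] surj by (simp add: surj_f_inv_f)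
      also have "\<dots> \<ge> \<kappa> * norm (inv ?T v)" using scale[OF x] by (intro mult_right_mono) auto
      finally show ?thesis using \<open>0 < \<kappa>\<close> by (simp add: field_simps)
    qed
    moreover have "(g has_derivative inv ?T) (at (f x))"
      by (rule has_derivative_inverse_strong[OF \<open>open V\<close> x cont gf df(1)])
        (use surj in \<open>auto simp: fun_eq_iff surj_f_inv_f\<close>)
    ultimately show ?thesis using \<open>0 < \<kappa>\<close> by (auto intro!: onorm_bound)
  qed
  \<comment> \<open>on the ball up to its first contact point \<open>f b\<close>, the inverse is Lipschitz\<close>
  have Lip: "dist a (g y) \<le> 1 / \<kappa> * dist (f a) y" if "y \<in> ball (f a) m" for y
  proof -
    have der: "(g has_derivative inv (frechet_derivative f (at (g z)))) (at z) \<and>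
      onorm (inv (frechet_derivative f (at (g z)))) \<le> 1 / \<kappa>" if z: "z \<in> ball (f a) m" for z
    proof -
      obtain x where x: "x \<in> ball a \<rho>" "z = f x" using z sub by blast
      then have "x \<in> V" using ballV by blast
      then show ?thesis using dg[of x] gf[of x] x(2) by simp
    qed
    have "f a \<in> ball (f a) m" using fab by (simp add: m_def)
    then have "norm (g (f a) - g y) \<le> 1 / \<kappa> * norm (f a - y)"
      using differentiable_bound[of "ball (f a) m" g "\<lambda>z. inv (frechet_derivative f (at (g z)))"]
        der that has_derivative_at_withinI convex_ball by blast
    then show ?thesis by (simp add: gf aV dist_norm)
  qed
  have "f b \<in> closure (ball (f a) m)" using fab by (simp add: m_def)
  then obtain s where s: "\<And>n. s n \<in> ball (f a) m" "s \<longlonglongrightarrow> f b"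
    unfolding closure_sequential by blast
  have "isCont g (f b)" using dg[OF bV] has_derivative_continuous by blast
  then have "(\<lambda>n. g (s n)) \<longlonglongrightarrow> g (f b)" using s(2) by (rule isCont_tendsto_compose)
  then have "(\<lambda>n. dist a (g (s n))) \<longlonglongrightarrow> dist a (g (f b))" by (intro tendsto_intros)
  moreover have "(\<lambda>n. 1 / \<kappa> * dist (f a) (s n)) \<longlonglongrightarrow> 1 / \<kappa> * dist (f a) (f b)"
    using s(2) by (intro tendsto_intros)
  ultimately have "dist a (g (f b)) \<le> 1 / \<kappa> * dist (f a) (f b)"
    using Lip s(1) by (auto intro: LIMSEQ_le)
  then have "\<rho> \<le> 1 / \<kappa> * m" using ab gf[OF bV] by (simp add: m_def)
  then have "\<kappa> * \<rho> \<le> m" using \<open>0 < \<kappa>\<close> by (simp add: field_simps)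
  then show ?thesis using sub by (meson order_trans subset_ball)
qed

text \<open>Compare volumes.\<close>

lemma card_disjoint_balls:
  fixes p :: "'i \<Rightarrow> 'a::euclidean_space"
  assumes "finite T" "0 < r" and "0 < R"
    and sub: "\<And>v. v \<in> T \<Longrightarrow> ball (p v) r \<subseteq> ball x R"
    and disj: "\<And>v w. v \<in> T \<Longrightarrow> w \<in> T \<Longrightarrow> v \<noteq> w \<Longrightarrow> ball (p v) r \<inter> ball (p w) r = {}"
  shows "real (card T) \<le> (R / r) ^ DIM('a)"
proof -
  let ?d = "DIM('a)"
  have "real (card T) * measure lborel (ball x r) = (\<Sum>v\<in>T. measure lborel (ball (p v) r))"
    using \<open>0 < r\<close> by (simp add: content_ball)
  also have "\<dots> = measure lborel (\<Union>v\<in>T. ball (p v) r)"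
    by (intro measure_finite_Union[symmetric])
      (use assms(1) disj in \<open>auto simp: disjoint_family_on_def emeasure_ball[OF less_imp_le[OF \<open>0 < r\<close>]]\<close>)
  also have "\<dots> \<le> measure lborel (ball x R)"
    using sub assms(1) by (intro measure_mono_fmeasurable) (auto simp: fmeasurable_def emeasure_ball[OF less_imp_le[OF \<open>0 < R\<close>]] intro!: sets.finite_UN)
  finally have "real (card T) * (unit_ball_vol ?d * r ^ ?d) \<le> unit_ball_vol ?d * R ^ ?d"
    using assms by (simp add: content_ball)
  then have "real (card T) * r ^ ?d \<le> R ^ ?d"
    using unit_ball_vol_pos[of ?d] by (simp add: mult.left_commute)
  then show ?thesis using \<open>0 < r\<close> by (simp add: power_divide pos_le_divide_eq)
qed

lemma conformal_diffeo_injective_conformal: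
  "conformal_diffeo_into V f \<Longrightarrow> injective_conformal V f"
  unfolding conformal_diffeo_into_def C1_diffeo_into_def C1_on_def injective_conformal_def
  by (auto simp: differentiable_def)

lemma D_scale_le_Lipschitz:
  fixes f :: "'a::euclidean_space \<Rightarrow> 'a"
  assumes f: "injective_conformal V f" and "x \<in> V" and x: "x \<in> interior S"
    and Lip: "\<And>y. y \<in> S \<Longrightarrow> norm (f y - f x) \<le> B * norm (y - x)"
  shows "D_scale f x \<le> B"
proof (rule field_le_epsilon)
  fix e :: real assume "0 < e"
  note df = injective_conformal_derivative[OF f \<open>x \<in> V\<close>]
  obtain d where d: "0 < d" "\<And>y. norm (y - x) < d \<Longrightarrow>
      norm (f y - f x - frechet_derivative f (at x) (y - x)) \<le> e * norm (y - x)"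
    using df(1) \<open>0 < e\<close> unfolding has_derivative_at_alt by blast
  obtain d' where d': "0 < d'" "ball x d' \<subseteq> S"
    using x by (auto simp: mem_interior)
  obtain b :: 'a where b: "b \<in> Basis" by (meson all_not_in_conv nonempty_Basis)
  define h where "h = min d d' / 2"
  have h: "0 < h" "h < d" "h < d'" using d(1) d'(1) by (auto simp: h_def min_def)
  define y where "y = x + h *\<^sub>R b"
  have n: "norm (y - x) = h" using b h by (simp add: y_def)
  then have "y \<in> S" using d'(2) h by (auto simp: dist_norm norm_minus_commute)
  have "D_scale f x * h = norm (frechet_derivative f (at x) (y - x))" using df(4) n by simp
  also have "\<dots> \<le> norm (f y - f x) + norm (f y - f x - frechet_derivative f (at x) (y - x))"
    using norm_triangle_ineq4[of "f y - f x" "f y - f x - frechet_derivative f (at x) (y - x)"] by simp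
  also have "\<dots> \<le> B * h + e * h"
    using Lip[OF \<open>y \<in> S\<close>] d(2)[of y] n h by (intro add_mono) auto
  also have "\<dots> = (B + e) * h" by (simp add: algebra_simps)
  finally show "D_scale f x \<le> B + e" using h by simp
qed

section \<open>Cylinders of a conformal system\<close>

text \<open>A conformal system satisfying the open set condition, with its contraction ratio \<open>c\<close> and its
  distortion constant \<open>C\<close> made explicit.\<close>

locale conformal_system =
  fixes I :: "nat \<Rightarrow> 'i set" and J V :: "'a::euclidean_space set"
    and \<phi> \<psi> :: "nat \<Rightarrow> 'i \<Rightarrow> 'a \<Rightarrow> 'a" and K :: "'i list \<Rightarrow> 'a set" and c C :: real
  assumes ifs: "nonautonomous_IFS I J \<phi> K"
    and ext: "conformal_extension I J \<phi> V \<psi>"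
    and osc: "open_set_condition I K"
    and c: "0 < c" "c < 1"
    and contraction: "\<And>k i x y. 1 \<le> k \<Longrightarrow> i \<in> I k \<Longrightarrow> x \<in> J \<Longrightarrow> y \<in> J \<Longrightarrow>
      norm (\<phi> k i x - \<phi> k i y) \<le> c * norm (x - y)"
    and C: "1 \<le> C"
    and distortion': "\<And>l k u x y. 1 \<le> l \<Longrightarrow> l \<le> k \<Longrightarrow> u \<in> words I l k \<Longrightarrow> x \<in> V \<Longrightarrow> y \<in> V \<Longrightarrow>
      D_scale (word_map \<psi> l u) x \<le> C * D_scale (word_map \<psi> l u) y"
begin

abbreviation W :: "'i list \<Rightarrow> real" where
  "W u \<equiv> D_norm J (word_map \<psi> 1 u)"

lemma J: "compact J" "interior J \<noteq> {}" "J \<noteq> {}" "J \<subseteq> V"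
  using ifs ext interior_subset[of J] unfolding nonautonomous_IFS_def conformal_extension_def by auto

lemma V: "open V" "connected V"
  using ext unfolding conformal_extension_def by auto

lemma finite_I: "1 \<le> k \<Longrightarrow> finite (I k)"
  using ifs unfolding nonautonomous_IFS_def by auto

lemma nonempty_I: "1 \<le> k \<Longrightarrow> I k \<noteq> {}"
  using ifs unfolding nonautonomous_IFS_def by fastforce

lemma \<phi>_J: "1 \<le> k \<Longrightarrow> i \<in> I k \<Longrightarrow> x \<in> J \<Longrightarrow> \<phi> k i x \<in> J"
  using ifs by (simp add: nonautonomous_IFS_def image_subset_iff)

lemma \<psi>_J: "1 \<le> k \<Longrightarrow> i \<in> I k \<Longrightarrow> x \<in> J \<Longrightarrow> \<psi> k i x = \<phi> k i x"
  using ext by (simp add: conformal_extension_def)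

lemma word_conformal: "1 \<le> l \<Longrightarrow> u \<in> words I l k \<Longrightarrow> injective_conformal V (word_map \<psi> l u)"
proof (induction u arbitrary: l)
  case Nil
  show ?case unfolding word_map.simps by (rule injective_conformal_id)
next
  case (Cons i u)
  have "conformal_diffeo_into V (\<psi> l i)"
    using ext words_Cons(1)[OF Cons.prems(2)] Cons.prems(1) unfolding conformal_extension_def by simp
  then have "injective_conformal V (\<psi> l i)" by (rule conformal_diffeo_injective_conformal)
  moreover have "injective_conformal V (word_map \<psi> (Suc l) u)"
    using Cons words_Cons[OF Cons.prems(2)] by simp
  ultimately show ?case unfolding word_map.simps by (rule injective_conformal_comp)
qed

lemma word_map_J:
  "1 \<le> l \<Longrightarrow> u \<in> words I l k \<Longrightarrow> x \<in> J \<Longrightarrow>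
    word_map \<psi> l u x = word_map \<phi> l u x \<and> word_map \<psi> l u x \<in> J"
proof (induction u arbitrary: l)
  case (Cons i u)
  have IH: "word_map \<psi> (Suc l) u x = word_map \<phi> (Suc l) u x" "word_map \<psi> (Suc l) u x \<in> J"
    using Cons.IH[OF le_SucI[OF Cons.prems(1)] words_Cons(2)[OF Cons.prems(2)] Cons.prems(3)] by blast+
  have "\<psi> l i (word_map \<psi> (Suc l) u x) = \<phi> l i (word_map \<phi> (Suc l) u x)"
    using \<psi>_J[OF Cons.prems(1) words_Cons(1)[OF Cons.prems(2)] IH(2)] IH(1) by simp
  moreover have "\<phi> l i (word_map \<phi> (Suc l) u x) \<in> J"
    using \<phi>_J[OF Cons.prems(1) words_Cons(1)[OF Cons.prems(2)] IH(2)] IH(1) by simp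
  ultimately show ?case by simp
qed simp

lemma word_map_contraction:
  "1 \<le> l \<Longrightarrow> u \<in> words I l k \<Longrightarrow> x \<in> J \<Longrightarrow> y \<in> J \<Longrightarrow>
    norm (word_map \<psi> l u x - word_map \<psi> l u y) \<le> c ^ length u * norm (x - y)"
proof (induction u arbitrary: l)
  case (Cons i u)
  note iu = words_Cons[OF Cons.prems(2)]
  let ?x = "word_map \<psi> (Suc l) u x" and ?y = "word_map \<psi> (Suc l) u y"
  have J: "?x \<in> J" "?y \<in> J" 
    using word_map_J[OF le_SucI[OF Cons.prems(1)] iu(2)] Cons.prems(3,4) by blast+
  have "norm (\<psi> l i ?x - \<psi> l i ?y) \<le> c * norm (?x - ?y)"
    using contraction[OF Cons.prems(1) iu(1) J] \<psi>_J[OF Cons.prems(1) iu(1)] J by simp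
  also have "\<dots> \<le> c * (c ^ length u * norm (x - y))"
    using Cons iu c by (intro mult_left_mono Cons.IH) auto
  finally show ?case by simp
qed simp

lemma distortion:
  assumes "1 \<le> l" "u \<in> words I l k" "x \<in> V" "y \<in> V"
  shows "D_scale (word_map \<psi> l u) x \<le> C * D_scale (word_map \<psi> l u) y"
proof (cases "l \<le> k")
  case True
  then show ?thesis using distortion' assms by blast
next
  case False
  then have "u = []" using assms(2) by (simp add: words_less)
  then show ?thesis using C by (simp add: D_scale_id)
qed

lemma D_scale_le_D_norm:
  assumes "1 \<le> l" "u \<in> words I l k" "x \<in> J"
  shows "D_scale (word_map \<psi> l u) x \<le> D_norm J (word_map \<psi> l u)"
  unfolding D_norm_def
proof (rule cSUP_upper[OF assms(3)])
  have "D_scale (word_map \<psi> l u) y \<le> C * D_scale (word_map \<psi> l u) x" if "y \<in> J" for y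
    using distortion[OF assms(1,2)] that assms(3) J(4) by blast
  then show "bdd_above (D_scale (word_map \<psi> l u) ` J)" by (intro bdd_aboveI2)
qed

lemma D_norm_le_D_scale:
  assumes "1 \<le> l" "u \<in> words I l k" "x \<in> V"
  shows "D_norm J (word_map \<psi> l u) \<le> C * D_scale (word_map \<psi> l u) x"
  unfolding D_norm_def using J(3,4) distortion[OF assms(1,2) _ assms(3)]
  by (intro cSUP_least) auto

lemma D_scale_le_C_D_norm:
  assumes "1 \<le> l" "u \<in> words I l k" "x \<in> V"
  shows "D_scale (word_map \<psi> l u) x \<le> C * D_norm J (word_map \<psi> l u)"
proof -
  obtain y where y: "y \<in> J" using J(3) by blast
  have "D_scale (word_map \<psi> l u) x \<le> C * D_scale (word_map \<psi> l u) y"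
    using distortion assms y J(4) by blast
  also have "\<dots> \<le> C * D_norm J (word_map \<psi> l u)"
    using C D_scale_le_D_norm[OF assms(1,2) y] by (intro mult_left_mono) auto
  finally show ?thesis .
qed

lemma D_norm_pos:
  assumes "1 \<le> l" "u \<in> words I l k"
  shows "0 < D_norm J (word_map \<psi> l u)"
proof -
  obtain y where y: "y \<in> J" using J(3) by blast
  then have "0 < D_scale (word_map \<psi> l u) y"
    using injective_conformal_derivative(3)[OF word_conformal[OF assms]] J(4) by blast
  also have "\<dots> \<le> D_norm J (word_map \<psi> l u)" by (rule D_scale_le_D_norm[OF assms y])
  finally show ?thesis .
qed

text \<open>The contraction ratio is known on \<open>J\<close> only, so it bounds the derivative at interior points of \<open>J\<close>;
  distortion carries the bound to the remaining points.\<close>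

lemma D_norm_le:
  assumes "1 \<le> l" "u \<in> words I l k"
  shows "D_norm J (word_map \<psi> l u) \<le> C * c ^ length u"
proof -
  obtain x where x: "x \<in> interior J" using J(2) by blast
  then have xJ: "x \<in> J" using interior_subset by blast
  have "D_norm J (word_map \<psi> l u) \<le> C * D_scale (word_map \<psi> l u) x"
    using D_norm_le_D_scale assms xJ J(4) by blast
  also have "\<dots> \<le> C * c ^ length u"
    using C xJ J(4) word_map_contraction[OF assms _ xJ]
    by (intro mult_left_mono D_scale_le_Lipschitz[OF word_conformal[OF assms] _ x]) auto
  finally show ?thesis .
qed

text \<open>By the chain rule both products equal, up to distortion, the product of the derivatives of the
  maps of \<open>w\<close>, \<open>w'\<close> and \<open>v\<close>.\<close>

lemma W_quasi_multiplicative: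
  assumes "m \<le> n" "w \<in> words I 1 m" "w' \<in> words I 1 m" "v \<in> words I (Suc m) n"
  shows "W (w @ v) * W w' \<le> C ^ 3 * W w * W (w' @ v)"
proof -
  obtain x where x: "x \<in> J" using J(3) by blast
  then have xV: "x \<in> V" using J(4) by blast
  define g where "g = word_map \<psi> (Suc m) v"
  have g: "injective_conformal V g" unfolding g_def using assms(4) by (intro word_conformal) auto
  have gx: "g x \<in> V" using g xV unfolding injective_conformal_def by blast
  have chain: "D_scale (word_map \<psi> 1 (z @ v)) x = D_scale (word_map \<psi> 1 z) (g x) * D_scale g x"
    if z: "z \<in> words I 1 m" for z
  proof -
    have "length z = m" using z by (simp add: words_def)
    then have "word_map \<psi> 1 (z @ v) = word_map \<psi> 1 z \<circ> g"
      by (simp add: word_map_append g_def)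
    then show ?thesis using D_scale_comp[OF word_conformal[OF _ z] g xV] by simp
  qed
  have wv: "w @ v \<in> words I 1 n" "w' @ v \<in> words I 1 n"
    using assms words_append_iff[of w I 1 m n v] words_append_iff[of w' I 1 m n v] by auto
  note pos = injective_conformal_derivative(3)[OF word_conformal[OF order_refl assms(2)] gx]
    injective_conformal_derivative(3)[OF word_conformal[OF order_refl assms(3)] gx]
    injective_conformal_derivative(3)[OF g xV]
    D_norm_pos[OF order_refl assms(2)] D_norm_pos[OF order_refl assms(3)]
  have "W (w @ v) * W w' \<le> (C * (D_scale (word_map \<psi> 1 w) (g x) * D_scale g x)) *
      (C * D_scale (word_map \<psi> 1 w') (g x))"
    using D_norm_le_D_scale[OF order_refl wv(1) xV] D_norm_le_D_scale[OF order_refl assms(3) gx]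
      pos C chain[OF assms(2)] by (intro mult_mono) auto
  also have "\<dots> = C ^ 2 * D_scale (word_map \<psi> 1 w) (g x) * D_scale (word_map \<psi> 1 (w' @ v)) x"
    unfolding chain[OF assms(3)] by (simp add: power2_eq_square)
  also have "\<dots> \<le> C ^ 2 * (C * W w) * W (w' @ v)"
    using D_scale_le_C_D_norm[OF order_refl assms(2) gx] D_scale_le_D_norm[OF order_refl wv(2) x] pos C
      chain[OF assms(3)]
    by (intro mult_mono mult_left_mono) auto
  also have "\<dots> = C ^ 3 * W w * W (w' @ v)" by (simp add: power2_eq_square power3_eq_cube)
  finally show ?thesis .
qed

lemma K_eq:
  assumes "u \<in> words I 1 k"
  obtains \<omega> where "K u = (\<lambda>x. word_map \<psi> 1 u x + \<omega>) ` J"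
proof -
  have "u \<in> all_words I" using assms by (auto simp: all_words_def)
  moreover have "\<forall>u\<in>all_words I. \<exists>\<omega>. K u = (\<lambda>x. word_map \<phi> 1 u x + \<omega>) ` J"
    using ifs unfolding nonautonomous_IFS_def by (elim conjE)
  ultimately obtain \<omega> where "K u = (\<lambda>x. word_map \<phi> 1 u x + \<omega>) ` J" by blast
  also have "\<dots> = (\<lambda>x. word_map \<psi> 1 u x + \<omega>) ` J"
    using word_map_J[OF _ assms] by (intro image_cong) auto
  finally show ?thesis by (rule that)
qed

lemma nested_K: "u \<in> words I 1 k \<Longrightarrow> i \<in> I (Suc k) \<Longrightarrow> K (u @ [i]) \<subseteq> K u"
proof -
  assume "u \<in> words I 1 k" "i \<in> I (Suc k)"
  moreover have "\<forall>k\<ge>1. \<forall>u\<in>words I 1 (k - 1). \<forall>i\<in>I k. K (u @ [i]) \<subseteq> K u"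
    using ifs by (simp add: nonautonomous_IFS_def)
  ultimately show ?thesis by (metis diff_Suc_1 le_add1 plus_1_eq_Suc)
qed

lemma compact_K:
  assumes "u \<in> words I 1 k"
  shows "compact (K u)"
proof -
  have "u \<in> all_words I" using assms by (auto simp: all_words_def)
  then have "closed (K u)" "K u \<subseteq> J" using ifs by (simp_all add: nonautonomous_IFS_def)
  then show ?thesis using J(1) by (metis compact_Int_closed inf.absorb_iff2 inf_commute)
qed

text \<open>Nesting reduces this to the first position at which the words differ, where the open set
  condition applies.\<close>

lemma interior_K_disjoint:
  "u \<in> words I 1 k \<Longrightarrow> v \<in> words I 1 k \<Longrightarrow> u \<noteq> v \<Longrightarrow> interior (K u) \<inter> interior (K v) = {}"
proof (induction k arbitrary: u v)
  case 0
  then show ?case by (simp add: words_less)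
next
  case (Suc k)
  obtain u' i v' j where uv: "u = u' @ [i]" "v = v' @ [j]" "u' \<in> words I 1 k" "v' \<in> words I 1 k"
    "i \<in> I (Suc k)" "j \<in> I (Suc k)"
    using Suc.prems(1,2) by (auto simp: words_Suc)
  show ?case
  proof (cases "u' = v'")
    case True
    then show ?thesis using osc uv Suc.prems(3) unfolding open_set_condition_def by auto
  next
    case False
    then have "interior (K u') \<inter> interior (K v') = {}" using Suc.IH uv by blast
    then show ?thesis
      using uv interior_mono[OF nested_K[OF uv(3,5)]] interior_mono[OF nested_K[OF uv(4,6)]] by blast
  qed
qed

lemma diameter_bound:
  "\<exists>L>0. \<forall>k. \<forall>u\<in>words I 1 k. diameter (K u) \<le> L * W u"
proof -
  obtain L where L: "0 < L" "\<And>(f :: 'a \<Rightarrow> 'a) f' B x y. (\<forall>z\<in>V. (f has_derivative f' z) (at z) \<and> onorm (f' z) \<le> B) \<Longrightarrow>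
      x \<in> J \<Longrightarrow> y \<in> J \<Longrightarrow> norm (f x - f y) \<le> L * B"
    using uniform_mean_value_on_compact[OF V J(1,4), where 'b = 'a] by blast
  have "diameter (K u) \<le> L * C * W u" if u: "u \<in> words I 1 k" for u k
  proof -
    let ?f = "word_map \<psi> 1 u"
    have "norm (?f x - ?f y) \<le> L * (C * W u)" if "x \<in> J" "y \<in> J" for x y
    proof (rule L(2)[of ?f "\<lambda>z. frechet_derivative ?f (at z)", OF _ that], intro ballI conjI)
      fix z assume z: "z \<in> V"
      show "(?f has_derivative frechet_derivative ?f (at z)) (at z)"
        by (rule injective_conformal_derivative(1)[OF word_conformal[OF order_refl u] z])
      show "onorm (frechet_derivative ?f (at z)) \<le> C * W u"
        using onorm_frechet_derivative[OF word_conformal[OF order_refl u] z]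
          D_scale_le_C_D_norm[OF order_refl u z] by simp
    qed
    moreover obtain \<omega> where "K u = (\<lambda>x. ?f x + \<omega>) ` J" by (rule K_eq[OF u])
    moreover have "0 \<le> L * (C * W u)" using L(1) C D_norm_pos[OF order_refl u] by simp
    ultimately have "diameter (K u) \<le> L * (C * W u)" by (intro diameter_le) auto
    then show ?thesis by (simp add: mult.assoc)
  qed
  moreover have "0 < L * C" using L(1) C by simp
  ultimately show ?thesis by blast
qed

text \<open>The ball comes from the image of one fixed ball in the interior of \<open>J\<close>.\<close>

lemma inner_ball:
  "\<exists>b>0. \<forall>k. \<forall>u\<in>words I 1 k. \<exists>p. ball p (b * W u) \<subseteq> K u"
proof -
  obtain a where "a \<in> interior J" using J(2) by blast
  then obtain \<rho> where \<rho>: "0 < \<rho>" "cball a \<rho> \<subseteq> interior J"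
    using open_contains_cball[of "interior J"] by auto
  have sub: "cball a \<rho> \<subseteq> J" "ball a \<rho> \<subseteq> J"
    using \<rho>(2) interior_subset[of J] ball_subset_cball[of a \<rho>] by blast+
  have "\<exists>p. ball p (\<rho> / C * W u) \<subseteq> K u" if u: "u \<in> words I 1 k" for u k
  proof -
    let ?f = "word_map \<psi> 1 u"
    have "ball (?f a) (W u / C * \<rho>) \<subseteq> ?f ` ball a \<rho>"
    proof (rule ball_subset_conformal_image[OF word_conformal[OF order_refl u] V(1) _ \<rho>(1)])
      show "cball a \<rho> \<subseteq> V" using sub J(4) by blast
      show "0 < W u / C" using D_norm_pos[OF order_refl u] C by simp
      show "W u / C \<le> D_scale ?f x" if "x \<in> V" for x
        using D_norm_le_D_scale[OF order_refl u that] C by (simp add: field_simps)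
    qed
    moreover obtain \<omega> where \<omega>: "K u = (\<lambda>x. ?f x + \<omega>) ` J" by (rule K_eq[OF u])
    ultimately have "(\<lambda>y. y + \<omega>) ` ball (?f a) (W u / C * \<rho>) \<subseteq> K u"
      using sub(2) by blast
    moreover have "(\<lambda>y. y + \<omega>) ` ball (?f a) (W u / C * \<rho>) = ball (?f a + \<omega>) (W u / C * \<rho>)"
      using ball_translation[of \<omega> "?f a" "W u / C * \<rho>"] by (simp add: add.commute)
    ultimately show ?thesis by (metis mult.commute times_divide_eq_left)
  qed
  moreover have "0 < \<rho> / C" using \<rho>(1) C by simp
  ultimately show ?thesis by blast
qed

text \<open>Cylinders of one level have disjoint interiors, those counted here have diameter at most
  \<open>2 L \<rho>\<close> and contain balls of radius \<open>b \<rho>\<close>; a comparison of volumes bounds their number.\<close>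

lemma packing_bound:
  "\<exists>N. \<forall>\<rho>>0. \<forall>k x.
    card {u \<in> words I 1 k. \<rho> < W u \<and> W u \<le> 2 * \<rho> \<and> K u \<inter> ball x \<rho> \<noteq> {}} \<le> N"
proof -
  obtain L where L: "0 < L" "\<And>u k. u \<in> words I 1 k \<Longrightarrow> diameter (K u) \<le> L * W u"
    using diameter_bound by blast
  obtain b where b: "0 < b" "\<And>u k. u \<in> words I 1 k \<Longrightarrow> \<exists>p. ball p (b * W u) \<subseteq> K u"
    using inner_ball by blast
  have "card {u \<in> words I 1 k. \<rho> < W u \<and> W u \<le> 2 * \<rho> \<and> K u \<inter> ball x \<rho> \<noteq> {}}
      \<le> nat \<lceil>((1 + 2 * L) / b) ^ DIM('a)\<rceil>" if \<rho>: "0 < \<rho>" for \<rho> k and x :: 'a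
  proof -
    let ?T = "{u \<in> words I 1 k. \<rho> < W u \<and> W u \<le> 2 * \<rho> \<and> K u \<inter> ball x \<rho> \<noteq> {}}"
    obtain p where p: "\<And>u. u \<in> words I 1 k \<Longrightarrow> ball (p u) (b * W u) \<subseteq> K u"
      using b(2) by metis
    have inner: "ball (p u) (b * \<rho>) \<subseteq> K u" if "u \<in> ?T" for u
    proof -
      have "b * \<rho> \<le> b * W u" using that b(1) by simp
      then show ?thesis using p[of u] that subset_ball by blast
    qed
    have "real (card ?T) \<le> ((1 + 2 * L) * \<rho> / (b * \<rho>)) ^ DIM('a)"
    proof (rule card_disjoint_balls)
      have "finite (words I 1 k)" by (rule finite_words[OF finite_I]) auto
      then show "finite ?T" by simp
      show "0 < b * \<rho>" "0 < (1 + 2 * L) * \<rho>" using b(1) L(1) \<rho> by auto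
      fix u assume u: "u \<in> ?T"
      then obtain z where z: "z \<in> K u" "dist x z < \<rho>" by auto
      have "K u \<subseteq> ball x ((1 + 2 * L) * \<rho>)"
      proof
        fix y assume y: "y \<in> K u"
        have uw: "u \<in> words I 1 k" using u by simp
        have "dist z y \<le> diameter (K u)"
          by (rule diameter_bounded_bound[OF compact_imp_bounded[OF compact_K[OF uw]] z(1) y])
        also have "\<dots> \<le> L * W u" by (rule L(2)[OF uw])
        also have "\<dots> \<le> L * (2 * \<rho>)" using u L(1) by (intro mult_left_mono) auto
        finally have "dist x y < \<rho> + L * (2 * \<rho>)"
          using dist_triangle[of x y z] z(2) by linarith
        then show "y \<in> ball x ((1 + 2 * L) * \<rho>)" by (simp add: algebra_simps)
      qed
      then show "ball (p u) (b * \<rho>) \<subseteq> ball x ((1 + 2 * L) * \<rho>)" using inner[OF u] by blast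
      fix v assume v: "v \<in> ?T" "u \<noteq> v"
      have "ball (p u) (b * \<rho>) \<subseteq> interior (K u)" "ball (p v) (b * \<rho>) \<subseteq> interior (K v)"
        using interior_maximal[OF inner[OF u] open_ball] interior_maximal[OF inner[OF v(1)] open_ball]
        by simp_all
      moreover have "interior (K u) \<inter> interior (K v) = {}"
        using u v by (intro interior_K_disjoint[of u k v]) auto
      ultimately show "ball (p u) (b * \<rho>) \<inter> ball (p v) (b * \<rho>) = {}" by blast
    qed
    also have "(1 + 2 * L) * \<rho> / (b * \<rho>) = (1 + 2 * L) / b" using \<rho> by simp
    finally show ?thesis by linarith
  qed
  then show ?thesis by blast
qed

text \<open>The upper bound is what lets the numerator of the growth hypothesis control \<open>card (I k)\<close>.\<close>

lemma c_max_bounds: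
  assumes "1 \<le> k"
  shows "0 < c_max I J \<psi> k" "c_max I J \<psi> k \<le> C"
proof -
  have "0 < D_norm J (\<psi> k j) \<and> D_norm J (\<psi> k j) \<le> C" if "j \<in> I k" for j
  proof -
    have word: "[j] \<in> words I k k" using that by (simp add: words_def)
    have "C * c \<le> C * 1" using C c by (intro mult_left_mono) auto
    then show ?thesis
      using D_norm_pos[OF assms word] D_norm_le[OF assms word] by simp
  qed
  moreover obtain j where "j \<in> I k" using nonempty_I[OF assms] by blast
  moreover have "D_norm J (\<psi> k j) \<le> c_max I J \<psi> k" if "j \<in> I k" for j
    unfolding c_max_def using that finite_I[OF assms] by (intro cSUP_upper bdd_above_finite) auto
  ultimately show "0 < c_max I J \<psi> k" "c_max I J \<psi> k \<le> C"
    unfolding c_max_def using nonempty_I[OF assms] by (fastforce intro: less_le_trans, intro cSUP_least, auto)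
qed

end


section \<open>The dimension formula\<close>

theorem corollary2p4:
  fixes I :: "nat \<Rightarrow> 'i set"
    and J V :: "'a::euclidean_space set"
    and \<phi> \<psi> :: "nat \<Rightarrow> 'i \<Rightarrow> 'a \<Rightarrow> 'a"
    and K :: "'i list \<Rightarrow> 'a set"
  assumes "nonautonomous_IFS I J \<phi> K"
    and "conformal_extension I J \<phi> V \<psi>"
    and "open_set_condition I K"
    and "emeasure lebesgue (frontier J) = 0"
    and "(\<lambda>k. (ln (c_max I J \<psi> k) - ln (real (card (I k)))) / ln (M_max I J \<psi> k)) \<longlonglongrightarrow> 0"
  shows "hausdorff_dim (attractor I K) = s_star I J \<psi>"
proof -
  have "\<exists>c. 0 < c \<and> c < 1 \<and>
      (\<forall>k\<ge>1. \<forall>i\<in>I k. \<forall>x\<in>J. \<forall>y\<in>J. norm (\<phi> k i x - \<phi> k i y) \<le> c * norm (x - y))"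
    using assms(1) unfolding nonautonomous_IFS_def by (elim conjE)
  then obtain c where c: "0 < c" "c < 1"
    "\<forall>k\<ge>1. \<forall>i\<in>I k. \<forall>x\<in>J. \<forall>y\<in>J. norm (\<phi> k i x - \<phi> k i y) \<le> c * norm (x - y)"
    by blast
  have "\<exists>C\<ge>1. \<forall>l\<ge>1. \<forall>k\<ge>l. \<forall>u\<in>words I l k. \<forall>x\<in>V. \<forall>y\<in>V.
      D_scale (word_map \<psi> l u) x \<le> C * D_scale (word_map \<psi> l u) y"
    using assms(2) unfolding conformal_extension_def by (elim conjE)
  then obtain C where C: "1 \<le> C"
    "\<forall>l\<ge>1. \<forall>k\<ge>l. \<forall>u\<in>words I l k. \<forall>x\<in>V. \<forall>y\<in>V.
      D_scale (word_map \<psi> l u) x \<le> C * D_scale (word_map \<psi> l u) y"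
    by blast
  interpret conformal_system I J V \<phi> \<psi> K c C
    by (unfold_locales) (use assms(1-3) c C in \<open>blast+\<close>)
  obtain L where L: "0 < L" "\<forall>k. \<forall>u\<in>words I 1 k. diameter (K u) \<le> L * W u"
    using diameter_bound by blast
  obtain N where N: "\<forall>\<rho>>0. \<forall>k x.
      card {u \<in> words I 1 k. \<rho> < W u \<and> W u \<le> 2 * \<rho> \<and> K u \<inter> ball x \<rho> \<noteq> {}} \<le> N"
    using packing_bound by blast
  interpret cylinders: cylinder_system I K W "C ^ 3" C c L N
  proof
    fix k u assume u: "u \<in> words I 1 k"
    obtain \<omega> where "K u = (\<lambda>x. word_map \<psi> 1 u x + \<omega>) ` J" by (rule K_eq[OF u])
    then show "K u \<noteq> {}" using J(3) by simp
    show "0 < W u" by (rule D_norm_pos[OF order_refl u])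
    have "length u = k" using u by (simp add: words_def)
    then show "W u \<le> C * c ^ k" using D_norm_le[OF order_refl u] by simp
    show "compact (K u)" by (rule compact_K[OF u])
    show "diameter (K u) \<le> L * W u" using L(2) u by blast
    show "K (u @ [i]) \<subseteq> K u" if "i \<in> I (Suc k)" for i by (rule nested_K[OF u that])
  next
    fix m n w w' v
    assume "m \<le> n" "w \<in> words I 1 m" "w' \<in> words I 1 m" "v \<in> words I (Suc m) n"
    then show "W (w @ v) * W w' \<le> C ^ 3 * W w * W (w' @ v)" by (rule W_quasi_multiplicative)
  next
    show "0 < C ^ 3" using C(1) by simp
    show "card {u \<in> words I 1 k. \<rho> < W u \<and> W u \<le> 2 * \<rho> \<and> K u \<inter> ball x \<rho> \<noteq> {}} \<le> N"
      if "0 < \<rho>" for \<rho> k x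
      using N that by blast
  qed (use finite_I nonempty_I c(1,2) L(1) in auto)
  have M: "M_max I J \<psi> k = cylinders.M k" for k
    unfolding M_max_def cylinders.M_def
    using cylinders.finite_word_set cylinders.word_set_nonempty by (intro cSup_eq_Max) auto
  have "\<forall>\<^sub>F k in sequentially. real (card (I k)) \<le> cylinders.M k powr (- \<epsilon>)" if \<epsilon>: "0 < \<epsilon>" for \<epsilon>
  proof -
    have "\<forall>\<^sub>F k in sequentially.
        (ln (c_max I J \<psi> k) - ln (real (card (I k)))) / ln (M_max I J \<psi> k) < \<epsilon> / 2"
      using order_tendstoD(2)[OF assms(5), of "\<epsilon> / 2"] \<epsilon> by simp
    \<comment> \<open>the second bound makes \<open>ln C\<close>, an upper bound for \<open>ln (c_max I J \<psi> k)\<close>, negligible\<close>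
    moreover have "\<forall>\<^sub>F k in sequentially. C * c ^ k < min 1 (C powr (- 2 / \<epsilon>))"
      using C(1) by (intro order_tendstoD(2)[OF cylinders.A_c_tendsto_0]) auto
    moreover have "\<forall>\<^sub>F k in sequentially. 1 \<le> k" by (rule eventually_ge_at_top)
    ultimately show ?thesis
    proof eventually_elim
      case (elim k)
      define x where "x = - ln (cylinders.M k)"
      have M_pos: "0 < cylinders.M k" by (rule cylinders.M_bounds)
      have M_less: "cylinders.M k < 1" "cylinders.M k < C powr (- 2 / \<epsilon>)"
        using cylinders.M_bounds(2)[of k] elim(2) by auto
      have x: "0 < x" using M_pos M_less(1) by (simp add: x_def)
      have "ln (cylinders.M k) < ln (C powr (- 2 / \<epsilon>))"
        using M_pos M_less(2) C(1) by (subst ln_less_cancel_iff) auto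
      then have lnC: "ln C \<le> \<epsilon> / 2 * x"
        using C(1) \<epsilon> by (simp add: x_def ln_powr field_simps)
      have "(ln (real (card (I k))) - ln (c_max I J \<psi> k)) / x < \<epsilon> / 2"
        using elim(1) M by (simp add: x_def minus_divide_left[symmetric] diff_divide_distrib)
      then have "ln (real (card (I k))) - ln (c_max I J \<psi> k) < \<epsilon> / 2 * x"
        using x by (simp add: pos_divide_less_eq)
      moreover have "ln (c_max I J \<psi> k) \<le> ln C"
        using c_max_bounds[OF elim(3)] by simp
      ultimately have "ln (real (card (I k))) \<le> \<epsilon> * x" using lnC by simp
      moreover have "0 < real (card (I k))"
        using finite_I[OF elim(3)] nonempty_I[OF elim(3)] by (simp add: card_gt_0_iff)
      ultimately have "real (card (I k)) \<le> exp (\<epsilon> * x)" by (metis exp_le_cancel_iff exp_ln)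
      then show ?case using M_pos by (simp add: powr_def x_def)
    qed
  qed
  then have "hausdorff_dim (attractor I K) = Inf {ereal t | t. cylinders.pressure t < 0}"
    by (rule cylinders.hausdorff_dim_attractor)
  moreover have "lower_pressure I J \<psi> t = cylinders.pressure t" for t
    unfolding lower_pressure_def cylinders.pressure_def cylinders.Z_def ..
  ultimately show ?thesis unfolding s_star_def by simp
qed

end
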